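(* Let $\mathcal{B}$ be a complete Boolean algebra, let $Q$ be the Stone space of $\mathcal{B}$, and let $X$ be an ideal in $C(Q)$. The following conditions are equivalent: (i) The Boolean algebra $\mathcal{B}_{s(X)}$ is $\sigma$-distributive. (ii) There are no non-zero band preserving derivations from $X$ with values in $L^0(\mathcal{B})$.
   Context: $L^0(\mathcal{B}):=C_\infty(Q)$ denotes the set of all continuous functions $x:Q\to[-\infty,+\infty]$ taking the values $\pm\infty$ at most on a nowhere dense set; with the usual operations (pointwise on a dense open set, extended by continuity) and pointwise order it is a commutative real algebra and a universally complete vector lattice. $C(Q)\subset L^0(\mathcal{B})$ is the subalgebra of continuous real-valued functions. $\mathcal{B}$ is identified with the Boolean algebra of idempotents of $L^0(\mathcal{B})$ (characteristic functions of clopen sets); $\mathbf{1}$ is the constant function one. For $e\in\mathcal{B}$, $\mathcal{B}_e=\{q\in\mathcal{B}:q\leqslant e\}$, a Boolean algebra with unit $e$ (the one-element algebra, trivially $\sigma$-distributive, if $e=\mathbf 0$). A $\sigma$-complete Boolean algebra is $\sigma$-distributive if $\bigvee_{n}\bigwedge_{m}e_{n,m}=\bigwedge_{\varphi\in\mathbb{N}^{\mathbb{N}}}\bigvee_{n}e_{n,\varphi(n)}$ for every double sequence $\{e_{n,m}\}_{n,m\in\mathbb{N}}$ in it. Support: for $x\in L^0(\mathcal{B})$, $s(x)=\mathbf{1}-\sup\{e\in\mathcal{B}:ex=0\}\in\mathcal{B}$; for non-empty $E\subset L^0(\mathcal{B})$, $s(E)=\sup\{s(x):x\in E\}$. An ideal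 in $C(Q)$ is a subalgebra $X\subset C(Q)$ with $xa\in X$ for all $x\in C(Q)$, $a\in X$. A derivation $\delta:X\to L^0(\mathcal{B})$ is a linear map with $\delta(xy)=\delta(x)y+x\delta(y)$ for all $x,y\in X$; it is band preserving if $s(\delta(x))\leqslant s(x)$ for all $x\in X$. *)

theory Defs
  imports "HOL-Analysis.Analysis"
begin

(* Complete Boolean algebras are the types of sort {boolean_algebra, complete_lattice}.
   The library class complete_boolean_algebra must not be used for them: it extends
   complete_distrib_lattice, which postulates complete distributivity, so every one of its
   instances is sigma-distributive. *)

definition ultrafilter_on_algebra :: "'b::boolean_algebra set \<Rightarrow> bool" where
  "ultrafilter_on_algebra U \<longleftrightarrow>
     top \<in> U \<and> bot \<notin> U \<and>
     (\<forall>a\<in>U. \<forall>b\<in>U. inf a b \<in> U) \<and>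
     (\<forall>a\<in>U. \<forall>b. a \<le> b \<longrightarrow> b \<in> U) \<and>
     (\<forall>a. a \<in> U \<or> - a \<in> U)"

(* The underlying set is the set of all ultrafilters, since it is the basic open set for a = top.
   An abstract topology is used so that the one-element algebra, whose Stone space is empty,
   is covered. *)
definition stone_space :: "'b::boolean_algebra set topology" where
  "stone_space = topology_generated_by (range (\<lambda>a. {U. ultrafilter_on_algebra U \<and> a \<in> U}))"

definition nowhere_dense_in :: "'q topology \<Rightarrow> 'q set \<Rightarrow> bool" where
  "nowhere_dense_in Q S \<longleftrightarrow> S \<subseteq> topspace Q \<and> Q interior_of (Q closure_of S) = {}"

(* Members are extensional, i.e. undefined off the space, so that equality of functions in HOL
   is equality on the space. *)
definition C_infinity :: "'q topology \<Rightarrow> ('q \<Rightarrow> ereal) set" where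
  "C_infinity Q = {x \<in> extensional (topspace Q).
     continuous_map Q euclidean x \<and> nowhere_dense_in Q {q \<in> topspace Q. \<bar>x q\<bar> = \<infinity>}}"

definition C_real :: "'q topology \<Rightarrow> ('q \<Rightarrow> ereal) set" where
  "C_real Q = {x \<in> C_infinity Q. \<forall>q\<in>topspace Q. \<bar>x q\<bar> \<noteq> \<infinity>}"

(* The member of C_infinity Q that agrees with f on a dense open set. It is unique because two
   dense open sets meet in a dense open set and ereal is Hausdorff. For the pointwise sums,
   products and multiples below it exists if Q is extremally disconnected, in particular if Q is
   the Stone space of a complete Boolean algebra. The dense open set can always be shrunk to
   points where all operands are finite, so library conventions for expressions such as
   PInfty + MInfty are irrelevant. *)
definition extend_dense :: "'q topology \<Rightarrow> ('q \<Rightarrow> ereal) \<Rightarrow> ('q \<Rightarrow> ereal)" where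
  "extend_dense Q f = (THE z. z \<in> C_infinity Q \<and>
     (\<exists>D. openin Q D \<and> Q closure_of D = topspace Q \<and> (\<forall>q\<in>D. z q = f q)))"

type_synonym 'b L0 = "'b set \<Rightarrow> ereal"

definition L0_carrier :: "'b::{boolean_algebra,complete_lattice} L0 set" where
  "L0_carrier = C_infinity stone_space"

definition CQ_carrier :: "'b::{boolean_algebra,complete_lattice} L0 set" where
  "CQ_carrier = C_real stone_space"

definition L0_zero :: "'b::{boolean_algebra,complete_lattice} L0" where
  "L0_zero = (\<lambda>q\<in>topspace stone_space. 0)"

definition L0_add ::
    "'b::{boolean_algebra,complete_lattice} L0 \<Rightarrow> 'b L0 \<Rightarrow> 'b L0" where
  "L0_add x y = extend_dense stone_space (\<lambda>q. x q + y q)"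

definition L0_mult ::
    "'b::{boolean_algebra,complete_lattice} L0 \<Rightarrow> 'b L0 \<Rightarrow> 'b L0" where
  "L0_mult x y = extend_dense stone_space (\<lambda>q. x q * y q)"

definition L0_scale :: "real \<Rightarrow> 'b::{boolean_algebra,complete_lattice} L0 \<Rightarrow> 'b L0" where
  "L0_scale c x = extend_dense stone_space (\<lambda>q. ereal c * x q)"

(* The identification of the algebra with the idempotents of L0: under Stone duality e
   corresponds to the clopen set of all ultrafilters containing e. *)
definition L0_idempotent :: "'b::{boolean_algebra,complete_lattice} \<Rightarrow> 'b L0" where
  "L0_idempotent e = (\<lambda>q\<in>topspace stone_space. if e \<in> q then 1 else 0)"

definition L0_support :: "'b::{boolean_algebra,complete_lattice} L0 \<Rightarrow> 'b" where
  "L0_support x = - Sup {e. L0_mult (L0_idempotent e) x = L0_zero}"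

definition L0_support_set :: "'b::{boolean_algebra,complete_lattice} L0 set \<Rightarrow> 'b" where
  "L0_support_set E = (SUP x\<in>E. L0_support x)"

(* Sigma-distributivity of the algebra {q. q \<le> e}. All suprema and infima involved are of
   nonempty families bounded by e, hence are the same in that algebra and in the whole algebra. *)
definition sigma_distributive_below :: "'b::{boolean_algebra,complete_lattice} \<Rightarrow> bool" where
  "sigma_distributive_below e \<longleftrightarrow>
     (\<forall>f::nat \<Rightarrow> nat \<Rightarrow> 'b. (\<forall>n m. f n m \<le> e) \<longrightarrow>
        (SUP n. INF m. f n m) = (INF \<phi>::nat \<Rightarrow> nat. SUP n. f n (\<phi> n)))"

definition CQ_subalgebra :: "'b::{boolean_algebra,complete_lattice} L0 set \<Rightarrow> bool" where
  "CQ_subalgebra X \<longleftrightarrow>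
     X \<subseteq> CQ_carrier \<and> L0_zero \<in> X \<and>
     (\<forall>x\<in>X. \<forall>y\<in>X. L0_add x y \<in> X) \<and>
     (\<forall>c. \<forall>x\<in>X. L0_scale c x \<in> X) \<and>
     (\<forall>x\<in>X. \<forall>y\<in>X. L0_mult x y \<in> X)"

definition CQ_ideal :: "'b::{boolean_algebra,complete_lattice} L0 set \<Rightarrow> bool" where
  "CQ_ideal X \<longleftrightarrow> CQ_subalgebra X \<and> (\<forall>x\<in>CQ_carrier. \<forall>a\<in>X. L0_mult x a \<in> X)"

definition L0_derivation ::
    "'b::{boolean_algebra,complete_lattice} L0 set \<Rightarrow> ('b L0 \<Rightarrow> 'b L0) \<Rightarrow> bool" where
  "L0_derivation X \<delta> \<longleftrightarrow>
     \<delta> \<in> X \<rightarrow> L0_carrier \<and>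
     (\<forall>x\<in>X. \<forall>y\<in>X. \<delta> (L0_add x y) = L0_add (\<delta> x) (\<delta> y)) \<and>
     (\<forall>c. \<forall>x\<in>X. \<delta> (L0_scale c x) = L0_scale c (\<delta> x)) \<and>
     (\<forall>x\<in>X. \<forall>y\<in>X. \<delta> (L0_mult x y) = L0_add (L0_mult (\<delta> x) y) (L0_mult x (\<delta> y)))"

definition band_preserving ::
    "'b::{boolean_algebra,complete_lattice} L0 set \<Rightarrow> ('b L0 \<Rightarrow> 'b L0) \<Rightarrow> bool" where
  "band_preserving X \<delta> \<longleftrightarrow> (\<forall>x\<in>X. L0_support (\<delta> x) \<le> L0_support x)"

end

theory Submission
  imports Defs "HOL-Computational_Algebra.Polynomial"
begin

text \<open>
  Both directions turn on one question: when is every element of $L^0(\mathcal{B})$ constant on many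
  clopen sets?

  Suppose that \<open>\<B>\<close> is \<open>\<sigma>\<close>-distributive below the support of \<open>X\<close>. Deciding, for every rational
  \<open>r\<close>, whether an element \<open>x\<close> lies below or above \<open>r\<close> amounts to countably many binary choices,
  so distributivity yields, below every nonzero idempotent under \<open>s(X)\<close>, a nonzero \<open>b\<close> on which \<open>x\<close> is
  a real constant (\<open>sigma_distributive_imp_constant_below\<close>). As \<open>X\<close> is an ideal, such \<open>b\<close> may be taken in \<open>X\<close>
  (\<open>ideal_contains_idempotent\<close>). A derivation kills idempotents, hence it kills \<open>b x = c b\<close>, and so
  \<open>b \<delta>(x) = 0\<close> for densely many \<open>b\<close> below \<open>s(X)\<close>. A band preserving \<open>\<delta>\<close> has \<open>s(\<delta>(x)) \<le> s(X)\<close>,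
  which forces \<open>\<delta>(x) = 0\<close>.

  Conversely, a double sequence that violates \<open>\<sigma>\<close>-distributivity is coded, in base three with
  digits 0 and 1, into a single continuous real function that is constant on no nonzero clopen subset of some
  \<open>e \<le> s(X)\<close> (\<open>not_sigma_distributive_imp_nowhere_constant\<close>). Shrinking \<open>e\<close> and multiplying by \<open>e\<close>
  gives \<open>v \<in> X\<close>. Over the algebra of locally constant elements, \<open>v\<close> behaves like a transcendental
  element on \<open>e\<close>: if \<open>p(v) = 0\<close> then \<open>p'(v)\<close> vanishes on \<open>e\<close>
  (\<open>transcendental_if_nowhere_constant\<close>). So the zero derivation on the locally constant elements
  extends to \<open>v\<close> with the value \<open>e\<close>, and Zorn's lemma extends it further to all of $L^0(\mathcal{B})$.
  A derivation on the whole algebra is band preserving because it kills idempotents; its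
  restriction to \<open>X\<close> is nonzero at \<open>v\<close>.

  The extension step replaces the classical argument with minimal polynomials, as
  $L^0(\mathcal{B})$ is not a field. A value \<open>y\<close> at a new element \<open>x\<close> is admissible iff
  \<open>p\<^sup>\<delta>(x) + y p'(x) = 0\<close> for all polynomials \<open>p\<close> over the domain with \<open>p(x) = 0\<close>, where \<open>p\<^sup>\<delta>\<close>
  results from \<open>p\<close> by applying \<open>\<delta>\<close> to the coefficients. This is a system of linear equations in one
  unknown. Its equations are pairwise compatible (\<open>wronskian_vanishes\<close>), each is solvable by itself
  (\<open>coeff_map_vanishes_at_double_root\<close>), and $L^0(\mathcal{B})$ is rich enough for such systems to
  have a common solution (\<open>linear_system_solvable\<close>), because local quotients can be glued on an open set and
  extended over the extremally disconnected Stone space.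
\<close>

section \<open>Formal derivatives of polynomials over an algebra without unit\<close>

text \<open>
  The factor of the n-th coefficient acts by scalar multiplication, so that the derivative makes
  sense over algebras with zero divisors and without a unit.
\<close>

definition fderiv :: "'a::{comm_ring, real_algebra} poly \<Rightarrow> 'a poly" where
  "fderiv p = Abs_poly (\<lambda>n. real (Suc n) *\<^sub>R coeff p (Suc n))"

lemma coeff_fderiv: "coeff (fderiv p) n = real (Suc n) *\<^sub>R coeff p (Suc n)"
  unfolding fderiv_def
  by (subst coeff_Abs_poly[where n = "degree p"]) (auto simp: coeff_eq_0)

lemma fderiv_0 [simp]: "fderiv 0 = 0"
  by (rule poly_eqI) (simp add: coeff_fderiv)

lemma fderiv_pCons: "fderiv (pCons a p) = p + pCons 0 (fderiv p)"
  by (rule poly_eqI)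
    (auto simp: coeff_fderiv coeff_pCons algebra_simps split: nat.splits)

lemma fderiv_add: "fderiv (p + q) = fderiv p + fderiv q"
  by (rule poly_eqI) (simp add: coeff_fderiv scaleR_add_right)

lemma fderiv_diff: "fderiv (p - q) = fderiv p - fderiv q"
  by (rule poly_eqI) (simp add: coeff_fderiv scaleR_diff_right)

lemma fderiv_smult: "fderiv (smult a p) = smult a (fderiv p)"
  by (rule poly_eqI) (simp add: coeff_fderiv)

lemma fderiv_mult: "fderiv (p * q) = fderiv p * q + p * fderiv q"
proof (induction p)
  case (pCons a p)
  then show ?case
    by (simp add: fderiv_pCons fderiv_add fderiv_smult algebra_simps)
qed simp

text \<open>
  Taylor expansion at \<open>x\<close>: over a real algebra the derivatives at one point
  determine a polynomial.
\<close>

lemma poly_eq_0_if_derivs_eq_0: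
  fixes p :: "'a::{comm_ring, real_algebra} poly"
  assumes "\<And>k. poly ((fderiv ^^ k) p) x = 0"
  shows "p = 0"
proof -
  have "p = 0" if "\<forall>i\<ge>n. coeff p i = 0" "\<forall>k. poly ((fderiv ^^ k) p) x = 0" for n
    using that
  proof (induction n arbitrary: p)
    case 0
    then show ?case by (auto intro: poly_eqI)
  next
    case (Suc n)
    have "fderiv p = 0"
    proof (rule Suc.IH)
      show "\<forall>i\<ge>n. coeff (fderiv p) i = 0"
        using Suc.prems(1) by (simp add: coeff_fderiv)
      show "\<forall>k. poly ((fderiv ^^ k) (fderiv p)) x = 0"
      proof
        fix k
        show "poly ((fderiv ^^ k) (fderiv p)) x = 0"
          using Suc.prems(2)[rule_format, of "Suc k"] by (simp add: funpow_swap1)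
      qed
    qed
    then have c: "coeff p (Suc i) = 0" for i
      using coeff_fderiv[of p i] by simp
    have "p = [:coeff p 0:]"
      by (rule poly_eqI) (auto simp: c coeff_pCons split: nat.splits)
    moreover have "poly p x = 0" using Suc.prems(2)[rule_format, of 0] by simp
    ultimately show ?case
      by (metis add.right_neutral mult_zero_right pCons_0_0 poly_0 poly_pCons)
  qed
  moreover have "\<forall>i\<ge>Suc (degree p). coeff p i = 0" by (simp add: coeff_eq_0)
  ultimately show ?thesis using assms by blast
qed

lemma coeff_monom_mult_no_unit:
  fixes q :: "'a::comm_ring poly"
  shows "coeff (monom a k * q) i = (if i < k then 0 else a * coeff q (i - k))"
proof (induction k arbitrary: i)
  case (Suc k)
  show ?case
    by (cases i) (auto simp: monom_Suc Suc.IH)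
qed (simp add: monom_0)


section \<open>Extension of derivations\<close>

text \<open>
  The part of the structure of $L^0(\mathcal{B})$ that extending derivations rests on. Every
  element has a support among the idempotents in \<open>E\<close>; and every family of linear
  equations \<open>y * r = s\<close> in one unknown that is pairwise compatible, and in
  which \<open>s\<close> vanishes wherever \<open>r\<close> does, has a common solution. The
  unit is a parameter because the algebra may be zero, which the type classes for unital rings
  exclude.
\<close>

locale saturated_algebra =
  fixes E :: "'a::{comm_ring, real_algebra} set" and u :: 'a
  assumes unit_in: "u \<in> E"
    and unit: "u * x = x"
    and idem: "e \<in> E \<Longrightarrow> e * e = e"
    and support: "\<exists>e\<in>E. e * r = r \<and> (\<forall>t. r * t = 0 \<longrightarrow> e * t = 0)"
    and solve: "\<And>M :: ('a \<times> 'a) set. (\<And>r s r' s'. (r, s) \<in> M \<Longrightarrow> (r', s') \<in> M \<Longrightarrow> r * s' = r' * s) \<Longrightarrow>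
      (\<And>r s t. (r, s) \<in> M \<Longrightarrow> r * t = 0 \<Longrightarrow> s * t = 0) \<Longrightarrow>
      \<exists>y. \<forall>(r, s)\<in>M. y * r = s"
begin

text \<open>
  A derivation on a subalgebra is handled as its graph, so that chains have unions. By
  additivity single-valuedness has to be required at 0 only.
\<close>

definition derivation_graph :: "('a \<times> 'a) set \<Rightarrow> bool" where
  "derivation_graph G \<longleftrightarrow>
    (\<forall>e\<in>E. (e, 0) \<in> G) \<and>
    (\<forall>a b a' b'. (a, b) \<in> G \<longrightarrow> (a', b') \<in> G \<longrightarrow>
       (a + a', b + b') \<in> G \<and> (a * a', b * a' + a * b') \<in> G) \<and>
    (\<forall>c a b. (a, b) \<in> G \<longrightarrow> (c *\<^sub>R a, c *\<^sub>R b) \<in> G) \<and>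
    (\<forall>b. (0, b) \<in> G \<longrightarrow> b = 0)"

end

locale partial_derivation = saturated_algebra E u
  for E :: "'a::{comm_ring, real_algebra} set" and u +
  fixes A :: "'a set" and \<delta> :: "'a \<Rightarrow> 'a"
  assumes E_sub: "E \<subseteq> A"
    and add_in: "a \<in> A \<Longrightarrow> b \<in> A \<Longrightarrow> a + b \<in> A"
    and mult_in: "a \<in> A \<Longrightarrow> b \<in> A \<Longrightarrow> a * b \<in> A"
    and scale_in: "a \<in> A \<Longrightarrow> c *\<^sub>R a \<in> A"
    and \<delta>_add: "a \<in> A \<Longrightarrow> b \<in> A \<Longrightarrow> \<delta> (a + b) = \<delta> a + \<delta> b"
    and \<delta>_mult: "a \<in> A \<Longrightarrow> b \<in> A \<Longrightarrow> \<delta> (a * b) = \<delta> a * b + a * \<delta> b"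
    and \<delta>_scale: "a \<in> A \<Longrightarrow> \<delta> (c *\<^sub>R a) = c *\<^sub>R \<delta> a"
begin

lemma zero_in: "0 \<in> A"
  using scale_in[of u 0] unit_in E_sub by auto

lemma diff_in: "a \<in> A \<Longrightarrow> b \<in> A \<Longrightarrow> a - b \<in> A"
  using add_in[of a "-1 *\<^sub>R b"] scale_in[of b "-1"] by simp

lemma \<delta>_0: "\<delta> 0 = 0"
  using \<delta>_scale[of u 0] unit_in E_sub by auto

lemma \<delta>_diff: "a \<in> A \<Longrightarrow> b \<in> A \<Longrightarrow> \<delta> (a - b) = \<delta> a - \<delta> b"
  using \<delta>_add[of a "-1 *\<^sub>R b"] \<delta>_scale[of b "-1"] scale_in[of b "-1"] by simp

lemma \<delta>_idem: assumes "e \<in> E" shows "\<delta> e = 0"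
proof -
  have "\<delta> e = \<delta> e * e + e * \<delta> e"
    using \<delta>_mult[of e e] idem assms E_sub by auto
  then have 1: "\<delta> e = e * \<delta> e + e * \<delta> e" by (simp add: mult.commute)
  then have "e * \<delta> e = e * (e * \<delta> e) + e * (e * \<delta> e)" by (metis distrib_left)
  then have "e * \<delta> e = 0"
    using idem[OF assms] by (simp add: mult.assoc[symmetric])
  then show ?thesis using 1 by simp
qed

definition over :: "'a poly \<Rightarrow> bool" where
  "over p \<longleftrightarrow> (\<forall>i. coeff p i \<in> A)"

lemma over_0: "over 0" by (simp add: over_def zero_in)

lemma over_pCons: "over (pCons a p) \<longleftrightarrow> a \<in> A \<and> over p"
  unfolding over_def by (auto simp: coeff_pCons split: nat.splits)

lemma over_add: "over p \<Longrightarrow> over q \<Longrightarrow> over (p + q)"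
  by (simp add: over_def add_in)

lemma over_diff: "over p \<Longrightarrow> over q \<Longrightarrow> over (p - q)"
  by (simp add: over_def diff_in)

lemma over_smult: "a \<in> A \<Longrightarrow> over p \<Longrightarrow> over (smult a p)"
  by (simp add: over_def mult_in)

lemma over_fderiv: "over p \<Longrightarrow> over (fderiv p)"
  by (simp add: over_def coeff_fderiv scale_in)

lemma over_monom: "a \<in> A \<Longrightarrow> over (monom a k)"
  by (simp add: over_def zero_in)

lemma over_mult: "over p \<Longrightarrow> over q \<Longrightarrow> over (p * q)"
  by (induction p)
    (auto simp: over_0 over_pCons intro!: over_add over_smult zero_in)

abbreviation coeff_map where "coeff_map \<equiv> map_poly \<delta>"

lemma coeff_coeff_map: "coeff (coeff_map p) i = \<delta> (coeff p i)"
  by (simp add: coeff_map_poly \<delta>_0)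

lemma coeff_map_add: "over p \<Longrightarrow> over q \<Longrightarrow> coeff_map (p + q) = coeff_map p + coeff_map q"
  by (rule poly_eqI) (simp add: coeff_coeff_map over_def \<delta>_add)

lemma coeff_map_diff: "over p \<Longrightarrow> over q \<Longrightarrow> coeff_map (p - q) = coeff_map p - coeff_map q"
  by (rule poly_eqI) (simp add: coeff_coeff_map over_def \<delta>_diff)

lemma coeff_map_smult:
  "a \<in> A \<Longrightarrow> over p \<Longrightarrow> coeff_map (smult a p) = smult (\<delta> a) p + smult a (coeff_map p)"
  by (rule poly_eqI) (simp add: coeff_coeff_map over_def \<delta>_mult)

lemma coeff_map_pCons: "coeff_map (pCons a p) = pCons (\<delta> a) (coeff_map p)"
  by (simp add: map_poly_pCons \<delta>_0)

lemma coeff_map_mult: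
  "over p \<Longrightarrow> over q \<Longrightarrow> coeff_map (p * q) = coeff_map p * q + p * coeff_map q"
proof (induction p)
  case (pCons a p)
  then have "a \<in> A" "over p" by (auto simp: over_pCons)
  with pCons show ?case
    by (simp add: coeff_map_add coeff_map_smult over_smult over_pCons zero_in over_mult
        coeff_map_pCons \<delta>_0 algebra_simps)
qed simp

text \<open>
  The linear conditions that two polynomials with root \<open>x\<close> impose on a derivation
  at \<open>x\<close> are proportional. Over a field both would be multiples of a minimal
  polynomial. Here the Euclidean algorithm works instead: the determinant changes by a factor
  under a pseudo-division step. The factor is the leading coefficient \<open>b\<close> of the
  divisor, which may be a zero divisor; off the support of \<open>b\<close> the divisor has
  smaller degree, so the induction covers that part as well.
\<close>

lemma wronskian_vanishes:
  assumes "over p" "over q" "poly p x = 0" "poly q x = 0"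
  shows "poly (fderiv p) x * poly (coeff_map q) x = poly (fderiv q) x * poly (coeff_map p) x"
proof -
  have "poly (fderiv p) x * poly (coeff_map q) x = poly (fderiv q) x * poly (coeff_map p) x"
    if "\<forall>i\<ge>m. coeff p i = 0" "\<forall>i\<ge>n. coeff q i = 0"
      "over p" "over q" "poly p x = 0" "poly q x = 0" for p q m n
    using that
  proof (induction "m + n" arbitrary: m n p q rule: less_induct)
    case less
    have main: "poly (fderiv p) x * poly (coeff_map q) x = poly (fderiv q) x * poly (coeff_map p) x"
      if mn: "n \<le> m" and
        IH: "\<And>m' n' p q. m' + n' < m + n \<Longrightarrow>
          \<forall>i\<ge>m'. coeff p i = 0 \<Longrightarrow> \<forall>i\<ge>n'. coeff q i = 0 \<Longrightarrow> over p \<Longrightarrow> over q \<Longrightarrow>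
          poly p x = 0 \<Longrightarrow> poly q x = 0 \<Longrightarrow>
          poly (fderiv p) x * poly (coeff_map q) x = poly (fderiv q) x * poly (coeff_map p) x"
        and pq: "\<forall>i\<ge>m. coeff p i = 0" "\<forall>i\<ge>n. coeff q i = 0"
          "over p" "over q" "poly p x = 0" "poly q x = 0" for p q m n
    proof (cases n)
      case 0
      then have "q = 0" using pq(2) by (auto intro: poly_eqI)
      then show ?thesis by simp
    next
      case (Suc n')
      define b where "b = coeff q n'"
      define a where "a = coeff p (m - 1)"
      define h where "h = monom a (m - n)"
      have aA: "a \<in> A" and bA: "b \<in> A" using pq by (auto simp: a_def b_def over_def)
      have hA: "over h" using aA by (simp add: h_def over_monom)
      \<comment> \<open>One step of pseudo-division: the leading terms cancel.\<close>
      define p1 where "p1 = smult b p - h * q"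
      have p1A: "over p1" using pq hA bA by (simp add: p1_def over_diff over_smult over_mult)
      have p1x: "poly p1 x = 0" using pq by (simp add: p1_def)
      have p1c: "\<forall>i\<ge>m - 1. coeff p1 i = 0"
      proof (intro allI impI)
        fix i assume i: "m - 1 \<le> i"
        show "coeff p1 i = 0"
        proof (cases "i = m - 1")
          case True
          then have "i - (m - n) = n'" "\<not> i < m - n" using Suc mn by auto
          then show ?thesis
            by (simp add: p1_def h_def coeff_monom_mult_no_unit True a_def b_def mult.commute[of "coeff q n'"])
        next
          case False
          then have "m \<le> i" "n \<le> i - (m - n)" using i mn Suc by auto
          then show ?thesis using pq by (simp add: p1_def h_def coeff_monom_mult_no_unit)
        qed
      qed
      have d1: "poly (fderiv p1) x = b * poly (fderiv p) x - poly h x * poly (fderiv q) x"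
        using pq by (simp add: p1_def fderiv_diff fderiv_smult fderiv_mult)
      have d2: "poly (coeff_map p1) x = b * poly (coeff_map p) x - poly h x * poly (coeff_map q) x"
        using pq hA bA
        by (simp add: p1_def coeff_map_diff over_smult over_mult coeff_map_smult coeff_map_mult)
      let ?W = "poly (fderiv p) x * poly (coeff_map q) x - poly (fderiv q) x * poly (coeff_map p) x"
      have "poly (fderiv p1) x * poly (coeff_map q) x = poly (fderiv q) x * poly (coeff_map p1) x"
        by (rule IH[of "m - 1" n]) (use Suc mn p1c pq p1A p1x in auto)
      then have bW: "b * ?W = 0"
        by (simp add: d1 d2 algebra_simps)
      obtain e where e: "e \<in> E" "e * b = b" "\<forall>t. b * t = 0 \<longrightarrow> e * t = 0"
        using support by blast
      \<comment> \<open>The idempotent of the region where \<open>b\<close> vanishes; multiplying by it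
        lowers the degree of \<open>q\<close>.\<close>
      define f where "f = u - e"
      have fA: "f \<in> A" using e(1) unit_in E_sub by (auto simp: f_def intro: diff_in)
      have \<delta>f: "\<delta> f = 0"
        using e(1) unit_in E_sub by (subst f_def, subst \<delta>_diff) (auto simp: \<delta>_idem)
      have fb: "f * b = 0" using e(2) unit by (simp add: f_def left_diff_distrib)
      have "\<forall>i\<ge>n'. coeff (smult f q) i = 0"
        using pq(2) Suc fb b_def by (auto simp: le_Suc_eq Suc_le_eq) (metis le_neq_implies_less mult_zero_right)
      then have "poly (fderiv p) x * poly (coeff_map (smult f q)) x
          = poly (fderiv (smult f q)) x * poly (coeff_map p) x"
        by (intro IH[of m n']) (use Suc pq fA in \<open>auto simp: over_smult\<close>)
      then have "f * ?W = 0"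
        using pq fA \<delta>f by (simp add: coeff_map_smult fderiv_smult algebra_simps)
      moreover have "e * ?W = 0" using e(3) bW by blast
      ultimately have "u * ?W = 0"
        unfolding f_def left_diff_distrib by simp
      then show ?thesis using unit by simp
    qed
    show ?case
    proof (cases "n \<le> m")
      case True
      show ?thesis
        by (rule main[OF True _ less.prems]) (rule less.hyps; assumption)
    next
      case False
      then have le: "m \<le> n" by simp
      show ?thesis
        by (rule main[OF le _ less.prems(2,1,4,3,6,5), symmetric])
           (rule less.hyps; simp)
    qed
  qed
  from this[of "Suc (degree p)" p "Suc (degree q)" q] show ?thesis
    using assms by (simp add: coeff_eq_0)
qed

text \<open>
  Compare \<open>p\<close> with its own higher derivatives: on the support of
  \<open>r = poly (coeff_map p) x\<close>, once the \<open>k\<close>-th derivative of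
  \<open>p\<close> vanishes at \<open>x\<close>, proportionality makes the next one vanish too.
  By Taylor expansion \<open>p\<close> itself is then zero on that support, and so is
  \<open>r\<close>.
\<close>

lemma coeff_map_vanishes_at_double_root:
  assumes p: "over p" "poly p x = 0" "poly (fderiv p) x = 0"
  shows "poly (coeff_map p) x = 0"
proof -
  define r where "r = poly (coeff_map p) x"
  obtain e where e: "e \<in> E" "e * r = r" "\<forall>t. r * t = 0 \<longrightarrow> e * t = 0"
    using support by blast
  have eA: "e \<in> A" and \<delta>e: "\<delta> e = 0" using e(1) E_sub \<delta>_idem by auto
  have ov: "over ((fderiv ^^ k) p)" for k
    by (induction k) (auto simp: p over_fderiv)
  have z: "e * poly ((fderiv ^^ k) p) x = 0" for k
  proof (induction k)
    case (Suc k)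
    let ?q = "(fderiv ^^ k) p"
    have "poly (fderiv p) x * poly (coeff_map (smult e ?q)) x
        = poly (fderiv (smult e ?q)) x * poly (coeff_map p) x"
      using Suc p eA ov[of k] by (intro wronskian_vanishes) (auto simp: over_smult)
    then have "r * (e * poly (fderiv ?q) x) = 0"
      using p by (simp add: fderiv_smult r_def mult.commute)
    then have "e * (e * poly (fderiv ?q) x) = 0" using e(3) by blast
    then show ?case using idem[OF e(1)] by (simp add: mult.assoc[symmetric])
  qed (simp add: p)
  have "(fderiv ^^ k) (smult e p) = smult e ((fderiv ^^ k) p)" for k
    by (induction k) (auto simp: fderiv_smult)
  then have "smult e p = 0"
    by (intro poly_eq_0_if_derivs_eq_0[of _ x]) (simp add: z)
  then have "coeff_map (smult e p) = 0" by simp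
  then have "smult e (coeff_map p) = 0"
    using coeff_map_smult[OF eA p(1)] \<delta>e by simp
  then have "e * r = 0" unfolding r_def by (metis poly_0 poly_smult)
  then show ?thesis using e(2) r_def by simp
qed

text \<open>
  The condition on \<open>y\<close> says that the value
  \<open>poly (coeff_map p) x + y * poly (fderiv p) x\<close>, which the Leibniz rule
  forces at the element \<open>poly p x\<close>, does not depend on the choice of
  \<open>p\<close>.
\<close>

lemma derivation_graph_adjoin:
  assumes y: "\<And>p. over p \<Longrightarrow> poly p x = 0 \<Longrightarrow> poly (coeff_map p) x + y * poly (fderiv p) x = 0"
  defines "G \<equiv> {(poly p x, poly (coeff_map p) x + y * poly (fderiv p) x) |p. over p}"
  shows "derivation_graph G" and "a \<in> A \<Longrightarrow> (a, \<delta> a) \<in> G" and "(x, y) \<in> G"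
proof -
  have const: "(a, \<delta> a) \<in> G" if "a \<in> A" for a
    unfolding G_def using that
    by (auto simp: over_pCons over_0 coeff_map_pCons fderiv_pCons intro!: exI[of _ "[:a:]"])
  then show "a \<in> A \<Longrightarrow> (a, \<delta> a) \<in> G" .
  have "u \<in> A" using unit_in E_sub by auto
  have "over [:0, u:]" using \<open>u \<in> A\<close> by (simp add: over_pCons over_0 zero_in)
  moreover have "x * u = x" "y * u = y" using unit mult.commute by metis+
  then have "x = poly [:0, u:] x"
    "y = poly (coeff_map [:0, u:]) x + y * poly (fderiv [:0, u:]) x"
    by (simp_all add: coeff_map_pCons fderiv_pCons \<delta>_0 \<delta>_idem[OF unit_in])
  ultimately show "(x, y) \<in> G" unfolding G_def by blast
  have G1: "(a + a', b + b') \<in> G \<and> (a * a', b * a' + a * b') \<in> G"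
    if ab: "(a, b) \<in> G" "(a', b') \<in> G" for a b a' b'
  proof -
    obtain p where p: "over p" "a = poly p x" "b = poly (coeff_map p) x + y * poly (fderiv p) x"
      using ab(1) unfolding G_def by blast
    obtain q where q: "over q" "a' = poly q x" "b' = poly (coeff_map q) x + y * poly (fderiv q) x"
      using ab(2) unfolding G_def by blast
    have "(a + a', b + b') \<in> G"
      unfolding G_def using p q over_add[of p q]
      by (auto simp: coeff_map_add fderiv_add algebra_simps intro!: exI[of _ "p + q"])
    moreover have "(a * a', b * a' + a * b') \<in> G"
      unfolding G_def using p q over_mult[of p q]
      by (auto simp: coeff_map_mult fderiv_mult algebra_simps intro!: exI[of _ "p * q"])
    ultimately show ?thesis ..
  qed
  have Gc: "(c *\<^sub>R u, 0) \<in> G" for c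
    using const[of "c *\<^sub>R u"] \<open>u \<in> A\<close> scale_in[of u c] \<delta>_scale[of u c] \<delta>_idem[OF unit_in] by simp
  show "derivation_graph G"
    unfolding derivation_graph_def
  proof (intro conjI allI ballI impI)
    fix e assume "e \<in> E"
    then show "(e, 0) \<in> G" using const[of e] E_sub \<delta>_idem by auto
  next
    fix c a b assume "(a, b) \<in> G"
    then show "(c *\<^sub>R a, c *\<^sub>R b) \<in> G"
      using G1[OF Gc[of c]] unit by fastforce
  next
    fix b assume "(0, b) \<in> G"
    then show "b = 0" unfolding G_def using y by auto
  qed (use G1 in blast)+
qed

text \<open>
  The admissible values \<open>y\<close> are the common solutions of a linear system.
  Proportionality of the conditions makes its equations compatible; the lemma on double roots,
  applied to multiples of \<open>p\<close> by idempotents, makes the right hand side vanish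
  wherever the left one does.
\<close>

lemma derivation_value_exists:
  "\<exists>y. \<forall>p. over p \<longrightarrow> poly p x = 0 \<longrightarrow> poly (coeff_map p) x + y * poly (fderiv p) x = 0"
proof -
  define M where "M = {(poly (fderiv p) x, - poly (coeff_map p) x) |p. over p \<and> poly p x = 0}"
  have "\<exists>y. \<forall>(r, s)\<in>M. y * r = s"
  proof (rule solve)
    fix r s r' s' assume M: "(r, s) \<in> M" "(r', s') \<in> M"
    obtain p where p: "over p" "poly p x = 0" "r = poly (fderiv p) x" "s = - poly (coeff_map p) x"
      using M(1) unfolding M_def by blast
    obtain q where q: "over q" "poly q x = 0" "r' = poly (fderiv q) x" "s' = - poly (coeff_map q) x"
      using M(2) unfolding M_def by blast
    show "r * s' = r' * s"
      using wronskian_vanishes[OF p(1) q(1) p(2) q(2)] p q by simp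
  next
    fix r s t assume "(r, s) \<in> M" and rt: "r * t = 0"
    then obtain p where p: "over p" "poly p x = 0" "r = poly (fderiv p) x" "s = - poly (coeff_map p) x"
      unfolding M_def by blast
    \<comment> \<open>On the support of \<open>t\<close> the polynomial has a double root at
      \<open>x\<close>.\<close>
    obtain e where e: "e \<in> E" "e * t = t" "\<forall>s. t * s = 0 \<longrightarrow> e * s = 0"
      using support by blast
    have eA: "e \<in> A" and \<delta>e: "\<delta> e = 0" using e(1) E_sub \<delta>_idem by auto
    have "e * r = 0" using e(3) rt mult.commute[of r t] by metis
    then have "poly (coeff_map (smult e p)) x = 0"
      using p eA by (intro coeff_map_vanishes_at_double_root) (auto simp: over_smult fderiv_smult)
    then have "e * s = 0" using p eA \<delta>e by (simp add: coeff_map_smult)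
    then have "t * (e * s) = 0" by simp
    then have "(e * t) * s = 0" by (metis mult.assoc mult.commute)
    then show "s * t = 0" using e(2) by (simp add: mult.commute)
  qed
  then obtain y where "\<forall>(r, s)\<in>M. y * r = s" ..
  then show ?thesis unfolding M_def by (intro exI[of _ y]) force
qed

end

context saturated_algebra
begin

lemma graph_partial_derivation:
  assumes G: "derivation_graph G"
  shows "partial_derivation E u (fst ` G) (\<lambda>a. THE b. (a, b) \<in> G)"
    and "(a, b) \<in> G \<Longrightarrow> (THE b. (a, b) \<in> G) = b"
proof -
  have add: "(a + a', b + b') \<in> G" and mult: "(a * a', b * a' + a * b') \<in> G"
    if "(a, b) \<in> G" "(a', b') \<in> G" for a b a' b'
    using G that by (simp_all add: derivation_graph_def)
  have scale: "(c *\<^sub>R a, c *\<^sub>R b) \<in> G" if "(a, b) \<in> G" for a b c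
    using G that by (simp add: derivation_graph_def)
  have E: "e \<in> E \<Longrightarrow> (e, 0) \<in> G" and zero: "(0, b) \<in> G \<Longrightarrow> b = 0" for b e
    using G by (simp_all add: derivation_graph_def)
  have uniq: "b = b'" if "(a, b) \<in> G" "(a, b') \<in> G" for a b b'
  proof -
    have "(0, b - b') \<in> G"
      using add[OF that(1) scale[OF that(2), of "-1"]] by simp
    then show ?thesis using zero by fastforce
  qed
  have the: "(THE b. (a, b) \<in> G) = b" if "(a, b) \<in> G" for a b
    using that uniq by blast
  then show "(a, b) \<in> G \<Longrightarrow> (THE b. (a, b) \<in> G) = b" .
  show "partial_derivation E u (fst ` G) (\<lambda>a. THE b. (a, b) \<in> G)"
  proof unfold_locales
    show "E \<subseteq> fst ` G" using E by force
  next
    fix a b assume "a \<in> fst ` G" "b \<in> fst ` G"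
    then obtain a' b' where ab: "(a, a') \<in> G" "(b, b') \<in> G" by auto
    from add[OF ab] show "a + b \<in> fst ` G" by force
    from mult[OF ab] show "a * b \<in> fst ` G" by force
    show "(THE c. (a + b, c) \<in> G) = (THE b. (a, b) \<in> G) + (THE c. (b, c) \<in> G)"
      using the[OF add[OF ab]] the[OF ab(1)] the[OF ab(2)] by simp
    show "(THE c. (a * b, c) \<in> G) = (THE b. (a, b) \<in> G) * b + a * (THE c. (b, c) \<in> G)"
      using the[OF mult[OF ab]] the[OF ab(1)] the[OF ab(2)] by simp
  next
    fix a c assume "a \<in> fst ` G"
    then obtain a' where a: "(a, a') \<in> G" by auto
    from scale[OF a] show "c *\<^sub>R a \<in> fst ` G" by force
    show "(THE b. (c *\<^sub>R a, b) \<in> G) = c *\<^sub>R (THE b. (a, b) \<in> G)"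
      using the[OF scale[OF a]] the[OF a] by simp
  qed
qed

lemma derivation_graph_Union:
  assumes C: "C \<noteq> {}" "\<And>G. G \<in> C \<Longrightarrow> derivation_graph G"
    and chain: "\<And>G H. G \<in> C \<Longrightarrow> H \<in> C \<Longrightarrow> G \<subseteq> H \<or> H \<subseteq> G"
  shows "derivation_graph (\<Union>C)"
  unfolding derivation_graph_def
proof (intro conjI allI ballI impI)
  fix e assume e: "e \<in> E"
  obtain G where G: "G \<in> C" using C(1) by blast
  with e C(2)[OF G] show "(e, 0) \<in> \<Union>C" by (auto simp: derivation_graph_def)
next
  fix a b a' b' assume "(a, b) \<in> \<Union>C" "(a', b') \<in> \<Union>C"
  then obtain G where G: "G \<in> C" "(a, b) \<in> G" "(a', b') \<in> G" using chain by blast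
  then have "(a + a', b + b') \<in> G" "(a * a', b * a' + a * b') \<in> G"
    using C(2)[OF G(1)] by (simp_all add: derivation_graph_def)
  then show "(a + a', b + b') \<in> \<Union>C" "(a * a', b * a' + a * b') \<in> \<Union>C" using G by blast+
next
  fix c a b assume "(a, b) \<in> \<Union>C"
  then obtain G where G: "G \<in> C" "(a, b) \<in> G" by blast
  then have "(c *\<^sub>R a, c *\<^sub>R b) \<in> G"
    using C(2)[OF G(1)] by (simp add: derivation_graph_def)
  then show "(c *\<^sub>R a, c *\<^sub>R b) \<in> \<Union>C" using G by blast
next
  fix b assume "(0, b) \<in> \<Union>C"
  then obtain G where G: "G \<in> C" "(0, b) \<in> G" by blast
  then show "b = 0" using C(2)[OF G(1)] by (simp add: derivation_graph_def)
qed

text \<open>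
  A maximal graph that contains \<open>G0\<close> is total, since any element missing from its
  domain could be adjoined.
\<close>

lemma derivation_graph_extends:
  assumes G0: "derivation_graph G0"
  obtains D where
    "\<And>a b. (a, b) \<in> G0 \<Longrightarrow> D a = b"
    "\<And>a b. D (a + b) = D a + D b"
    "\<And>a b. D (a * b) = D a * b + a * D b"
    "\<And>c a. D (c *\<^sub>R a) = c *\<^sub>R D a"
proof -
  let ?S = "{G. derivation_graph G \<and> G0 \<subseteq> G}"
  have "\<exists>G\<in>?S. \<forall>H\<in>?S. G \<subseteq> H \<longrightarrow> H = G"
  proof (rule subset_Zorn_nonempty)
    show "?S \<noteq> {}" using G0 by blast
    fix C assume C: "C \<noteq> {}" "subset.chain ?S C"
    then have "derivation_graph (\<Union>C)"
      by (intro derivation_graph_Union) (auto simp: subset_chain_def)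
    moreover have "G0 \<subseteq> \<Union>C" using C unfolding subset_chain_def by blast
    ultimately show "\<Union>C \<in> ?S" by simp
  qed
  then obtain G where G: "derivation_graph G" "G0 \<subseteq> G"
    and max: "\<And>H. derivation_graph H \<Longrightarrow> G \<subseteq> H \<Longrightarrow> H = G"
    by auto
  define D where "D = (\<lambda>a. THE b. (a, b) \<in> G)"
  interpret P: partial_derivation E u "fst ` G" D
    unfolding D_def by (rule graph_partial_derivation(1)[OF G(1)])
  have DG: "(a, b) \<in> G \<Longrightarrow> D a = b" for a b
    unfolding D_def by (rule graph_partial_derivation(2)[OF G(1)])
  have total: "x \<in> fst ` G" for x
  proof -
    obtain y where y: "\<And>p. P.over p \<Longrightarrow> poly p x = 0 \<Longrightarrow>
        poly (map_poly D p) x + y * poly (fderiv p) x = 0"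
      using P.derivation_value_exists[of x] by blast
    define H where "H = {(poly p x, poly (map_poly D p) x + y * poly (fderiv p) x) |p. P.over p}"
    have H: "derivation_graph H" "\<And>a. a \<in> fst ` G \<Longrightarrow> (a, D a) \<in> H" "(x, y) \<in> H"
      unfolding H_def using P.derivation_graph_adjoin[OF y] by blast+
    have "G \<subseteq> H"
    proof
      fix z assume z: "z \<in> G"
      then have "(fst z, D (fst z)) \<in> H" "D (fst z) = snd z"
        using H(2)[of "fst z"] DG[of "fst z" "snd z"] by auto
      then show "z \<in> H" by simp
    qed
    then have "H = G" by (rule max[OF H(1)])
    then show ?thesis using H(3) by force
  qed
  show thesis
  proof (rule that)
    show "(a, b) \<in> G0 \<Longrightarrow> D a = b" for a b using DG G(2) by blast
  qed (simp_all only: P.\<delta>_add[OF total total] P.\<delta>_mult[OF total total] P.\<delta>_scale[OF total])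
qed

end

section \<open>The Stone space of a complete Boolean algebra\<close>

text \<open>
  Meets distribute over arbitrary joins in every complete Boolean algebra, as each
  \<open>inf a\<close> has a right adjoint; for joins with value 0 the adjoint is the
  complement of \<open>a\<close>.
\<close>

lemma inf_Sup_eq_bot:
  fixes a :: "'b::{boolean_algebra,complete_lattice}"
  assumes "\<And>b. b \<in> S \<Longrightarrow> inf a b = bot"
  shows "inf a (Sup S) = bot"
proof -
  have "Sup S \<le> - a"
  proof (rule Sup_least)
    fix b assume "b \<in> S"
    then have "inf b a = bot" using assms by (metis inf.commute)
    then show "b \<le> - a" by (simp add: inf_shunt)
  qed
  then have "inf (Sup S) a = bot" by (simp add: inf_shunt)
  then show ?thesis by (metis inf.commute)
qed

lemma uf_inf: "ultrafilter_on_algebra q \<Longrightarrow> inf a b \<in> q \<longleftrightarrow> a \<in> q \<and> b \<in> q"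
  unfolding ultrafilter_on_algebra_def by (metis inf_le1 inf_le2)

lemma uf_top: "ultrafilter_on_algebra q \<Longrightarrow> top \<in> q"
  and uf_bot: "ultrafilter_on_algebra q \<Longrightarrow> bot \<notin> q"
  and uf_mono: "ultrafilter_on_algebra q \<Longrightarrow> a \<in> q \<Longrightarrow> a \<le> b \<Longrightarrow> b \<in> q"
  unfolding ultrafilter_on_algebra_def by blast+

lemma uf_compl: "ultrafilter_on_algebra q \<Longrightarrow> - a \<in> q \<longleftrightarrow> a \<notin> q"
  using uf_inf[of q a "- a"] uf_bot[of q] unfolding ultrafilter_on_algebra_def by auto

text \<open>
  The Boolean prime ideal theorem: a maximal proper filter that contains \<open>a\<close> is an
  ultrafilter.
\<close>

lemma ultrafilter_exists:
  fixes a :: "'b::boolean_algebra"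
  assumes "a \<noteq> bot"
  obtains q where "ultrafilter_on_algebra q" "a \<in> q"
proof -
  define S where "S = {F :: 'b set. a \<in> F \<and> bot \<notin> F \<and> (\<forall>b\<in>F. \<forall>c\<in>F. inf b c \<in> F) \<and>
    (\<forall>b\<in>F. \<forall>c. b \<le> c \<longrightarrow> c \<in> F)}"
  have "\<exists>F\<in>S. \<forall>H\<in>S. F \<subseteq> H \<longrightarrow> H = F"
  proof (rule subset_Zorn_nonempty)
    have "{b. a \<le> b} \<in> S" using assms by (auto simp: S_def bot_unique)
    then show "S \<noteq> {}" by blast
    fix C assume C: "C \<noteq> {}" "subset.chain S C"
    then have sub: "F \<in> S" if "F \<in> C" for F using that by (auto simp: subset_chain_def)
    have inf: "inf b c \<in> \<Union>C" if bc: "b \<in> \<Union>C" "c \<in> \<Union>C" for b c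
    proof -
      obtain F where F: "F \<in> C" "b \<in> F" "c \<in> F"
        using bc C(2) unfolding subset_chain_def by blast
      then have "inf b c \<in> F" using sub[OF F(1)] unfolding S_def by blast
      then show ?thesis using F by blast
    qed
    have up: "c \<in> \<Union>C" if bc: "b \<in> \<Union>C" "b \<le> c" for b c
    proof -
      obtain F where F: "F \<in> C" "b \<in> F" using bc by blast
      then have "c \<in> F" using sub[OF F(1)] bc(2) unfolding S_def by blast
      then show ?thesis using F by blast
    qed
    have "a \<in> F" "bot \<notin> F" if "F \<in> C" for F using sub[OF that] by (simp_all add: S_def)
    then have "a \<in> \<Union>C" "bot \<notin> \<Union>C" using C(1) by blast+
    then show "\<Union>C \<in> S"
      unfolding S_def mem_Collect_eq by (intro conjI ballI allI impI) (simp_all only: inf up not_False_eq_True)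
  qed
  then obtain F where F: "F \<in> S" and max: "\<forall>H\<in>S. F \<subseteq> H \<longrightarrow> H = F" ..
  have aF: "a \<in> F" and bF: "bot \<notin> F" using F by (auto simp: S_def)
  have infF: "inf b c \<in> F" if "b \<in> F" "c \<in> F" for b c using F that by (simp add: S_def)
  have upF: "c \<in> F" if "b \<in> F" "b \<le> c" for b c using F that unfolding S_def by blast
  have "- b \<in> F" if b: "b \<notin> F" for b
  proof -
    define H where "H = {c. \<exists>f\<in>F. inf f b \<le> c}"
    have "F \<subseteq> H" unfolding H_def using inf_le1[of _ b] by (auto intro!: bexI)
    have "b \<in> H" unfolding H_def using aF inf_le2[of a b] by blast
    then have "H \<notin> S" using max \<open>F \<subseteq> H\<close> b by blast
    have "bot \<in> H"
    proof (rule ccontr)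
      assume "bot \<notin> H"
      moreover have "a \<in> H" using aF \<open>F \<subseteq> H\<close> by blast
      moreover have "inf c d \<in> H" if cd: "c \<in> H" "d \<in> H" for c d
      proof -
        obtain f g where fg: "f \<in> F" "g \<in> F" "inf f b \<le> c" "inf g b \<le> d"
          using cd unfolding H_def by blast
        have "inf (inf f g) b \<le> c"
          by (rule order_trans[OF _ fg(3)]) (simp add: le_infI1)
        moreover have "inf (inf f g) b \<le> d"
          by (rule order_trans[OF _ fg(4)]) (simp add: le_infI1)
        ultimately have "inf (inf f g) b \<le> inf c d" by simp
        then show ?thesis unfolding H_def using infF[OF fg(1,2)] by blast
      qed
      moreover have "d \<in> H" if "c \<in> H" "c \<le> d" for c d
        using that unfolding H_def by (blast intro: order_trans)
      ultimately have "H \<in> S"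
        unfolding S_def mem_Collect_eq by (intro conjI ballI allI impI) simp_all
      then show False using \<open>H \<notin> S\<close> by blast
    qed
    then obtain f where "f \<in> F" "inf f b = bot" unfolding H_def by (auto simp: bot_unique)
    then show ?thesis using upF by (simp add: inf_shunt)
  qed
  then have "ultrafilter_on_algebra F"
    unfolding ultrafilter_on_algebra_def using aF bF infF upF upF[OF aF top_greatest] by metis
  then show thesis using that aF by blast
qed

definition clopen_of :: "'b::boolean_algebra \<Rightarrow> 'b set set" where
  "clopen_of a = {q. ultrafilter_on_algebra q \<and> a \<in> q}"

lemma topspace_stone_space: "topspace stone_space = {q. ultrafilter_on_algebra q}"
  unfolding stone_space_def by (auto intro: uf_top)

lemma clopen_of_eq_empty_iff: "clopen_of a = {} \<longleftrightarrow> a = bot"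
  using ultrafilter_exists[of a] uf_bot by (auto simp: clopen_of_def)

lemma openin_clopen_of: "openin stone_space (clopen_of a)"
  unfolding stone_space_def clopen_of_def by (rule topology_generated_by_Basis) blast

lemma openin_stone_space_iff:
  "openin stone_space W \<longleftrightarrow>
    (\<forall>q\<in>W. ultrafilter_on_algebra q \<and> (\<exists>a\<in>q. clopen_of a \<subseteq> W))"
proof
  assume "openin stone_space W"
  then have "generate_topology_on (range clopen_of) W"
    unfolding stone_space_def openin_topology_generated_by_iff clopen_of_def .
  then show "\<forall>q\<in>W. ultrafilter_on_algebra q \<and> (\<exists>a\<in>q. clopen_of a \<subseteq> W)"
  proof induction
    case (Int V W)
    show ?case
    proof
      fix q assume "q \<in> V \<inter> W"
      then obtain a b where ab: "ultrafilter_on_algebra q"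
        "a \<in> q" "clopen_of a \<subseteq> V" "b \<in> q" "clopen_of b \<subseteq> W" using Int.IH by blast
      then have "inf a b \<in> q" "clopen_of (inf a b) \<subseteq> V \<inter> W"
        by (auto simp: clopen_of_def uf_inf)
      then show "ultrafilter_on_algebra q \<and> (\<exists>a\<in>q. clopen_of a \<subseteq> V \<inter> W)" using ab(1) by blast
    qed
  next
    case (UN K)
    show ?case
    proof
      fix q assume "q \<in> \<Union>K"
      then obtain k where k: "k \<in> K" "q \<in> k" by blast
      then obtain a where "ultrafilter_on_algebra q" "a \<in> q" "clopen_of a \<subseteq> k"
        using UN.IH[OF k(1)] by meson
      moreover have "k \<subseteq> \<Union>K" using k(1) by (rule Union_upper)
      ultimately show "ultrafilter_on_algebra q \<and> (\<exists>a\<in>q. clopen_of a \<subseteq> \<Union>K)"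
        by (meson order_trans)
    qed
  qed (auto simp: clopen_of_def)
next
  assume *: "\<forall>q\<in>W. ultrafilter_on_algebra q \<and> (\<exists>a\<in>q. clopen_of a \<subseteq> W)"
  have "W = \<Union>(clopen_of ` {a. clopen_of a \<subseteq> W})"
    using * by (auto simp: clopen_of_def)
  then show "openin stone_space W"
    using openin_clopen_of by (metis (no_types, lifting) imageE openin_Union)
qed

lemma openin_stone_spaceE:
  assumes "openin stone_space W" "q \<in> W"
  obtains a where "a \<in> q" "clopen_of a \<subseteq> W" "ultrafilter_on_algebra q" "a \<noteq> bot"
proof -
  obtain a where a: "ultrafilter_on_algebra q" "a \<in> q" "clopen_of a \<subseteq> W"
    using assms unfolding openin_stone_space_iff by blast
  then have "a \<noteq> bot" using uf_bot[of q] by metis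
  then show thesis using that a by blast
qed

lemma dense_in_stone_space_iff:
  assumes "D \<subseteq> topspace stone_space"
  shows "stone_space closure_of D = topspace stone_space \<longleftrightarrow> (\<forall>a. a \<noteq> bot \<longrightarrow> D \<inter> clopen_of a \<noteq> {})"
proof
  assume dense: "stone_space closure_of D = topspace stone_space"
  show "\<forall>a. a \<noteq> bot \<longrightarrow> D \<inter> clopen_of a \<noteq> {}"
  proof (intro allI impI)
    fix a :: 'a assume "a \<noteq> bot"
    then obtain q where q: "q \<in> clopen_of a" using clopen_of_eq_empty_iff by blast
    then have "q \<in> stone_space closure_of D"
      unfolding dense topspace_stone_space by (simp add: clopen_of_def)
    then show "D \<inter> clopen_of a \<noteq> {}"
      using q openin_clopen_of unfolding in_closure_of by blast
  qed
next
  assume *: "\<forall>a. a \<noteq> bot \<longrightarrow> D \<inter> clopen_of a \<noteq> {}"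
  show "stone_space closure_of D = topspace stone_space"
  proof (intro equalityI subsetI)
    fix q :: "'a set" assume q: "q \<in> topspace stone_space"
    show "q \<in> stone_space closure_of D"
      unfolding in_closure_of
    proof (intro conjI q allI impI)
      fix T assume T: "q \<in> T \<and> openin stone_space T"
      then obtain a where "a \<in> q" "clopen_of a \<subseteq> T" "a \<noteq> bot"
        by (auto elim: openin_stone_spaceE)
      then show "\<exists>y. y \<in> D \<and> y \<in> T" using * by blast
    qed
  qed (simp add: closure_of_def)
qed

text \<open>
  The Stone space of a complete Boolean algebra is extremally disconnected: the closure of an
  open set is the clopen set of the supremum of all the elements inside it.
\<close>

lemma closure_of_open_stone_space:
  fixes W :: "'b::{boolean_algebra,complete_lattice} set set"
  assumes W: "openin stone_space W"
  shows "stone_space closure_of W = clopen_of (Sup {a. clopen_of a \<subseteq> W})"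
    (is "_ = clopen_of ?e")
proof (intro equalityI subsetI)
  fix q assume q: "q \<in> stone_space closure_of W"
  then have uq: "ultrafilter_on_algebra q" by (simp add: in_closure_of topspace_stone_space)
  have False if "- ?e \<in> q"
  proof -
    have "q \<in> clopen_of (- ?e)" using uq that by (simp add: clopen_of_def)
    then obtain p where p: "p \<in> W" "p \<in> clopen_of (- ?e)"
      using q openin_clopen_of unfolding in_closure_of by blast
    obtain a where a: "a \<in> p" "clopen_of a \<subseteq> W" "ultrafilter_on_algebra p"
      using openin_stone_spaceE[OF W p(1)] by metis
    have "a \<le> ?e" using a(2) by (simp add: Sup_upper)
    then show False using uf_mono[OF a(3,1)] p(2) uf_compl[OF a(3)] by (simp add: clopen_of_def)
  qed
  then show "q \<in> clopen_of ?e" using uq uf_compl[OF uq, of ?e] by (auto simp: clopen_of_def)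
next
  fix q assume q: "q \<in> clopen_of ?e"
  then have uq: "ultrafilter_on_algebra q" by (simp add: clopen_of_def)
  show "q \<in> stone_space closure_of W"
    unfolding in_closure_of topspace_stone_space mem_Collect_eq
  proof (intro conjI uq allI impI; rule ccontr)
    fix T assume T: "q \<in> T \<and> openin stone_space T" and "\<nexists>y. y \<in> W \<and> y \<in> T"
    then obtain a where a: "a \<in> q" "clopen_of a \<inter> W = {}"
      using openin_stone_spaceE[of T q] by (metis disjoint_iff subsetD)
    have "inf a ?e = bot"
    proof (rule inf_Sup_eq_bot)
      fix b assume "b \<in> {b. clopen_of b \<subseteq> W}"
      moreover have "clopen_of (inf a b) \<subseteq> clopen_of a \<inter> clopen_of b"
        by (auto simp: clopen_of_def uf_inf)
      ultimately have "clopen_of (inf a b) = {}" using a by blast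
      then show "inf a b = bot" by (simp add: clopen_of_eq_empty_iff)
    qed
    then show False
      using uf_inf[OF uq, of a ?e] uf_bot[OF uq] a(1) q by (simp add: clopen_of_def)
  qed
qed

lemma continuous_map_linorder:
  fixes f :: "'q \<Rightarrow> 'a::linorder_topology"
  assumes "\<And>c. openin T {q \<in> topspace T. f q < c}" "\<And>c. openin T {q \<in> topspace T. c < f q}"
  shows "continuous_map T euclidean f"
proof -
  have "openin T {q \<in> topspace T. f q \<in> U}" if "open U" for U
  proof -
    from that have "generate_topology (range (\<lambda>a. {..<a}) \<union> range (\<lambda>a. {a<..})) U"
      by (simp add: open_generated_order)
    then show ?thesis
    proof induction
      case (Int A B)
      have "{q \<in> topspace T. f q \<in> A \<inter> B} = {q \<in> topspace T. f q \<in> A} \<inter> {q \<in> topspace T. f q \<in> B}"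
        by blast
      then show ?case using Int by auto
    next
      case (UN K)
      have "{q \<in> topspace T. f q \<in> \<Union>K} = (\<Union>k\<in>K. {q \<in> topspace T. f q \<in> k})" by blast
      then show ?case using UN by auto
    qed (use assms in auto)
  qed
  then show ?thesis by (simp add: continuous_map_def)
qed

text \<open>
  The closures of the sets \<open>{f < c}\<close> are clopen and increase with
  \<open>c\<close>; they serve as the lower level sets of the extension \<open>F\<close>. Since
  these sets are clopen and not only open, both \<open>{F < c}\<close> and
  \<open>{F > c}\<close> are unions of clopen sets. Values in the compact space of extended
  reals guarantee that the infimum that defines \<open>F\<close> always exists.
\<close>

lemma continuous_extension_from_open:
  fixes D :: "'b::{boolean_algebra,complete_lattice} set set" and f :: "'b set \<Rightarrow> ereal"
  assumes D: "openin stone_space D"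
    and f: "continuous_map (subtopology stone_space D) euclidean f"
  obtains x where "x \<in> extensional (topspace stone_space)"
    "continuous_map stone_space euclidean x" "\<And>q. q \<in> D \<Longrightarrow> x q = f q"
proof -
  have Duf: "ultrafilter_on_algebra q" if "q \<in> D" for q
    using D that openin_stone_space_iff by blast
  have topD: "topspace (subtopology stone_space D) = D"
    using openin_subset[OF D] by (rule topspace_subtopology_subset)
  have ray: "openin stone_space {q \<in> D. f q \<in> U}" if "open U" for U
    using openin_continuous_map_preimage[OF f, of U] D that
    unfolding topD by (simp add: openin_open_subtopology)
  define lev where "lev c = Sup {a. clopen_of a \<subseteq> {q \<in> D. f q < c}}" for c
  have lev_mono: "lev c \<le> lev d" if "c \<le> d" for c d
    unfolding lev_def by (rule Sup_subset_mono) (use that in auto)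
  have lev: "stone_space closure_of {q \<in> D. f q < c} = clopen_of (lev c)" for c
    unfolding lev_def using ray[of "{..<c}"] by (intro closure_of_open_stone_space) simp
  have lev_in: "lev c \<in> q" if q: "q \<in> D" "f q < c" for q c
  proof -
    have "{q \<in> D. f q < c} \<subseteq> topspace stone_space" using openin_subset[OF D] by blast
    then have "q \<in> clopen_of (lev c)" unfolding lev[symmetric]
      using closure_of_subset q by blast
    then show ?thesis by (simp add: clopen_of_def)
  qed
  have lev_notin: "lev c \<notin> q" if q: "q \<in> D" "c < f q" for q c
  proof
    assume "lev c \<in> q"
    then have "q \<in> stone_space closure_of {q \<in> D. f q < c}"
      unfolding lev using Duf[OF q(1)] by (simp add: clopen_of_def)
    moreover have "openin stone_space {q \<in> D. c < f q}" using ray[of "{c<..}"] by simp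
    moreover have "q \<in> {q \<in> D. c < f q}" using q by simp
    ultimately obtain p where "p \<in> {q \<in> D. f q < c}" "p \<in> {q \<in> D. c < f q}"
      unfolding in_closure_of by meson
    then show False by auto
  qed
  define F where "F q = Inf {c. lev c \<in> q}" for q
  have F_less: "F q < c \<longleftrightarrow> (\<exists>d<c. lev d \<in> q)" for q c
    unfolding F_def by (auto simp: Inf_less_iff)
  have F_greater: "c < F q \<longleftrightarrow> (\<exists>d>c. lev d \<notin> q)" if "ultrafilter_on_algebra q" for q c
  proof
    assume "c < F q"
    then obtain d where "c < d" "d < F q" using dense by blast
    moreover from this have "lev d \<notin> q" unfolding F_def by (metis Inf_lower mem_Collect_eq not_le)
    ultimately show "\<exists>d>c. lev d \<notin> q" by blast
  next
    assume "\<exists>d>c. lev d \<notin> q"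
    then obtain d where d: "c < d" "lev d \<notin> q" by blast
    have "d \<le> F q"
      unfolding F_def
    proof (rule Inf_greatest)
      fix e assume "e \<in> {c. lev c \<in> q}"
      then show "d \<le> e" using d(2) lev_mono[of e d] uf_mono[OF that, of "lev e" "lev d"] by force
    qed
    then show "c < F q" using d by order
  qed
  have cont: "continuous_map stone_space euclidean F"
  proof (rule continuous_map_linorder)
    fix c
    have "{q \<in> topspace stone_space. F q < c} = (\<Union>d\<in>{d. d < c}. clopen_of (lev d))"
      by (auto simp: F_less clopen_of_def topspace_stone_space)
    then show "openin stone_space {q \<in> topspace stone_space. F q < c}"
      using openin_clopen_of by auto
    have "{q \<in> topspace stone_space. c < F q} = (\<Union>d\<in>{d. c < d}. clopen_of (- lev d))"
      by (auto simp: F_greater clopen_of_def topspace_stone_space uf_compl)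
    then show "openin stone_space {q \<in> topspace stone_space. c < F q}"
      using openin_clopen_of by auto
  qed
  have eq: "F q = f q" if q: "q \<in> D" for q
  proof (rule antisym)
    show "F q \<le> f q"
    proof (rule ccontr)
      assume "\<not> F q \<le> f q"
      then have "f q < F q" by simp
      then obtain c where c: "f q < c" "c < F q" using dense[of "f q" "F q"] by metis
      have "F q \<le> c"
        unfolding F_def by (rule Inf_lower) (simp add: lev_in[OF q c(1)])
      then show False using c(2) by simp
    qed
    show "f q \<le> F q"
      unfolding F_def by (rule Inf_greatest) (metis lev_notin[OF q] mem_Collect_eq not_le)
  qed
  show thesis
  proof (rule that)
    show "restrict F (topspace stone_space) \<in> extensional (topspace stone_space)" by simp
    show "continuous_map stone_space euclidean (restrict F (topspace stone_space))"
      using cont by (rule continuous_map_eq) simp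
    show "restrict F (topspace stone_space) q = f q" if "q \<in> D" for q
      using eq[OF that] Duf[OF that] by (simp add: topspace_stone_space)
  qed
qed

lemma C_infinity_stone_space_iff:
  fixes x :: "'b::{boolean_algebra,complete_lattice} set \<Rightarrow> ereal"
  shows "x \<in> C_infinity stone_space \<longleftrightarrow> x \<in> extensional (topspace stone_space) \<and>
    continuous_map stone_space euclidean x \<and>
    (\<forall>a. a \<noteq> bot \<longrightarrow> (\<exists>q\<in>clopen_of a. \<bar>x q\<bar> \<noteq> \<infinity>))"
proof -
  let ?S = "{q \<in> topspace stone_space. \<bar>x q\<bar> = \<infinity>}"
  have "nowhere_dense_in stone_space ?S \<longleftrightarrow> (\<forall>a. a \<noteq> bot \<longrightarrow> (\<exists>q\<in>clopen_of a. \<bar>x q\<bar> \<noteq> \<infinity>))"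
    if x: "continuous_map stone_space euclidean x"
  proof -
    have "closedin stone_space {q \<in> topspace stone_space. x q \<in> {\<infinity>, -\<infinity>}}"
      by (rule closedin_continuous_map_preimage[OF x]) auto
    moreover have "{q \<in> topspace stone_space. x q \<in> {\<infinity>, -\<infinity>}} = ?S"
      by (auto simp: abs_ereal.simps elim!: abs_ereal.elims)
    ultimately have cl: "stone_space closure_of ?S = ?S" by (simp add: closure_of_closedin)
    have "stone_space interior_of ?S = {} \<longleftrightarrow> (\<forall>a. a \<noteq> bot \<longrightarrow> \<not> clopen_of a \<subseteq> ?S)"
    proof
      assume empty: "stone_space interior_of ?S = {}"
      show "\<forall>a. a \<noteq> bot \<longrightarrow> \<not> clopen_of a \<subseteq> ?S"
      proof (intro allI impI notI)
        fix a :: 'b assume "a \<noteq> bot" "clopen_of a \<subseteq> ?S"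
        then have "clopen_of a \<subseteq> {}"
          using interior_of_maximal[OF _ openin_clopen_of] empty by metis
        then show False using \<open>a \<noteq> bot\<close> clopen_of_eq_empty_iff[of a] by simp
      qed
    next
      assume *: "\<forall>a. a \<noteq> bot \<longrightarrow> \<not> clopen_of a \<subseteq> ?S"
      show "stone_space interior_of ?S = {}"
      proof (rule ccontr)
        assume "stone_space interior_of ?S \<noteq> {}"
        then obtain q where q: "q \<in> stone_space interior_of ?S" by blast
        obtain a where "clopen_of a \<subseteq> stone_space interior_of ?S" "a \<noteq> bot"
          by (rule openin_stone_spaceE[OF openin_interior_of q])
        then show False using * interior_of_subset[of stone_space ?S] by (meson order_trans)
      qed
    qed
    also have "\<dots> \<longleftrightarrow> (\<forall>a. a \<noteq> bot \<longrightarrow> (\<exists>q\<in>clopen_of a. \<bar>x q\<bar> \<noteq> \<infinity>))"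
      by (auto simp: topspace_stone_space clopen_of_def subset_iff)
    finally show ?thesis unfolding nowhere_dense_in_def cl by blast
  qed
  then show ?thesis unfolding C_infinity_def by blast
qed

lemma continuous_eq_if_agree_densely:
  fixes x y :: "'b::{boolean_algebra,complete_lattice} set \<Rightarrow> ereal"
  assumes "continuous_map stone_space euclidean x" "continuous_map stone_space euclidean y"
    and "\<And>b. b \<noteq> bot \<Longrightarrow> b \<le> a \<Longrightarrow> \<exists>q\<in>clopen_of b. x q = y q"
    and q: "q \<in> clopen_of a"
  shows "x q = y q"
proof (rule ccontr)
  assume ne: "x q \<noteq> y q"
  have uq: "ultrafilter_on_algebra q" using q by (simp add: clopen_of_def)
  obtain U V where UV: "open U" "open V" "x q \<in> U" "y q \<in> V" "U \<inter> V = {}"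
    using hausdorff[OF ne] by blast
  let ?W = "{p \<in> topspace stone_space. x p \<in> U} \<inter> {p \<in> topspace stone_space. y p \<in> V}"
  have "openin stone_space ?W"
    by (intro openin_Int openin_continuous_map_preimage[OF assms(1)]
        openin_continuous_map_preimage[OF assms(2)]) (use UV in \<open>simp_all\<close>)
  moreover have "q \<in> ?W" using UV uq by (simp add: topspace_stone_space)
  ultimately obtain b where b: "b \<in> q" "clopen_of b \<subseteq> ?W"
    using openin_stone_space_iff by blast
  have "inf a b \<in> q" using q b uq by (simp add: clopen_of_def uf_inf)
  then have "inf a b \<noteq> bot" using uf_bot[OF uq] by metis
  then obtain p where p: "p \<in> clopen_of (inf a b)" "x p = y p" using assms(3)[of "inf a b"] by auto
  have "clopen_of (inf a b) \<subseteq> clopen_of b" by (auto simp: clopen_of_def uf_inf)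
  then have "p \<in> ?W" using p b by blast
  then show False using p(2) UV(5) by auto
qed

text \<open>
  This shows that the description in \<open>extend_dense\<close> is met by exactly one function,
  and identifies its values on all of \<open>D\<close>; all later computations with
  \<open>L0_add\<close>, \<open>L0_mult\<close> and \<open>L0_scale\<close> go through it.
\<close>

lemma extend_dense_correct:
  fixes D :: "'b::{boolean_algebra,complete_lattice} set set"
  assumes D: "openin stone_space D" "\<And>a. a \<noteq> bot \<Longrightarrow> D \<inter> clopen_of a \<noteq> {}"
    and f: "continuous_map (subtopology stone_space D) euclidean f" "\<And>q. q \<in> D \<Longrightarrow> \<bar>f q\<bar> \<noteq> \<infinity>"
  shows "extend_dense stone_space f \<in> C_infinity stone_space"
    and "q \<in> D \<Longrightarrow> extend_dense stone_space f q = f q"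
proof -
  let ?P = "\<lambda>z. z \<in> C_infinity stone_space \<and>
     (\<exists>D. openin stone_space D \<and> stone_space closure_of D = topspace stone_space \<and> (\<forall>q\<in>D. z q = f q))"
  obtain x where x: "x \<in> extensional (topspace stone_space)"
    "continuous_map stone_space euclidean x" "\<And>q. q \<in> D \<Longrightarrow> x q = f q"
    using continuous_extension_from_open[OF D(1) f(1)] by blast
  have xC: "x \<in> C_infinity stone_space"
    unfolding C_infinity_stone_space_iff
  proof (intro conjI x(1,2) allI impI)
    fix a :: 'b assume "a \<noteq> bot"
    then obtain q where "q \<in> D" "q \<in> clopen_of a" using D(2) by blast
    then show "\<exists>q\<in>clopen_of a. \<bar>x q\<bar> \<noteq> \<infinity>" using x(3) f(2) by metis
  qed
  have Dsub: "D \<subseteq> topspace stone_space" using D(1) openin_subset by blast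
  have "extend_dense stone_space f = x"
    unfolding extend_dense_def
  proof (rule the_equality)
    show "?P x"
      using xC D x(3) dense_in_stone_space_iff[OF Dsub] by blast
    fix z assume "?P z"
    then obtain D' where z: "z \<in> C_infinity stone_space" and D': "openin stone_space D'"
      "stone_space closure_of D' = topspace stone_space" "\<forall>q\<in>D'. z q = f q" by blast
    have sub: "D' \<subseteq> topspace stone_space" using D'(1) openin_subset by blast
    show "z = x"
    proof (rule extensionalityI)
      show "z \<in> extensional (topspace stone_space)" using z by (simp add: C_infinity_def)
      fix q assume "q \<in> topspace (stone_space :: 'b set topology)"
      then have q: "q \<in> clopen_of top" by (simp add: topspace_stone_space clopen_of_def uf_top)
      show "z q = x q"
      proof (rule continuous_eq_if_agree_densely[OF _ x(2) _ q])
        show "continuous_map stone_space euclidean z" using z by (simp add: C_infinity_def)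
        fix b :: 'b assume "b \<noteq> bot" 
        then obtain p where p: "p \<in> D" "p \<in> clopen_of b" using D(2) by blast
        have "openin stone_space (D \<inter> clopen_of b)" using D(1) openin_clopen_of by blast
        then obtain c where c: "clopen_of c \<subseteq> D \<inter> clopen_of b" "c \<noteq> bot"
          using p by (metis IntI openin_stone_spaceE)
        then obtain r where "r \<in> D'" "r \<in> clopen_of c"
          using D'(2) dense_in_stone_space_iff[OF sub] by blast
        then show "\<exists>q\<in>clopen_of b. z q = x q" using c D'(3) x(3) by (metis IntD1 IntD2 subsetD)
      qed
    qed (rule x(1))
  qed
  then show "extend_dense stone_space f \<in> C_infinity stone_space"
    and "q \<in> D \<Longrightarrow> extend_dense stone_space f q = f q" using xC x(3) by simp_all
qed

section \<open>The algebra of extended continuous functions\<close>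

lemma L0_zero_in_carrier: "L0_zero \<in> (L0_carrier :: 'b::{boolean_algebra,complete_lattice} L0 set)"
proof -
  have "continuous_map stone_space euclidean (L0_zero :: 'b L0)"
    unfolding L0_zero_def by (rule continuous_map_eq[of _ _ "\<lambda>_. 0"]) auto
  moreover have "\<exists>q\<in>clopen_of a. \<bar>(L0_zero :: 'b L0) q\<bar> \<noteq> \<infinity>" if "a \<noteq> bot" for a :: 'b
    using that clopen_of_eq_empty_iff[of a]
    by (auto simp: L0_zero_def clopen_of_def topspace_stone_space)
  ultimately show ?thesis
    unfolding L0_carrier_def C_infinity_stone_space_iff by (auto simp: L0_zero_def)
qed

text \<open>
  As a type, the carrier can be made an instance of the classes of rings and real algebras,
  which gives access to polynomials over it.
\<close>

typedef (overloaded) ('b::"{boolean_algebra,complete_lattice}") l0 = "L0_carrier :: 'b L0 set"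
  using L0_zero_in_carrier by blast

definition fin :: "'b::{boolean_algebra,complete_lattice} l0 \<Rightarrow> 'b set \<Rightarrow> bool" where
  "fin x q \<longleftrightarrow> ultrafilter_on_algebra q \<and> \<bar>Rep_l0 x q\<bar> \<noteq> \<infinity>"

text \<open>
  Meaningful where \<open>x\<close> is finite; elsewhere it is 0.
\<close>

definition val :: "'b set \<Rightarrow> 'b::{boolean_algebra,complete_lattice} l0 \<Rightarrow> real" where
  "val q x = real_of_ereal (Rep_l0 x q)"

lemma fin_uf: "fin x q \<Longrightarrow> ultrafilter_on_algebra q"
  by (simp add: fin_def)

lemma Rep_l0_eq_val: "fin x q \<Longrightarrow> Rep_l0 x q = ereal (val q x)"
  by (simp add: fin_def val_def ereal_real)

lemma continuous_Rep_l0: "continuous_map stone_space euclidean (Rep_l0 x)"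
  using Rep_l0[of x] by (simp add: L0_carrier_def C_infinity_def)

lemma fin_exists: "a \<noteq> bot \<Longrightarrow> \<exists>q\<in>clopen_of a. fin x q"
  using Rep_l0[of x] unfolding L0_carrier_def C_infinity_stone_space_iff fin_def
  by (auto simp: clopen_of_def)

lemma openin_Rep_l0_vimage:
  assumes "open U"
  shows "openin stone_space {q. ultrafilter_on_algebra q \<and> Rep_l0 x q \<in> U}"
  using openin_continuous_map_preimage[OF continuous_Rep_l0, of U x] assms
  by (simp add: topspace_stone_space)

lemma openin_fin: "openin stone_space {q. fin x q}"
proof -
  have "{q. fin x q} = {q. ultrafilter_on_algebra q \<and> Rep_l0 x q \<in> - {\<infinity>, -\<infinity>}}"
    by (auto simp: fin_def)
  then show ?thesis using openin_Rep_l0_vimage[of "- {\<infinity>, -\<infinity>}" x] by (simp add: open_Compl)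
qed

lemma clopen_of_mono: "a \<le> b \<Longrightarrow> clopen_of a \<subseteq> clopen_of b"
  by (auto simp: clopen_of_def uf_mono)

lemma clopen_of_inf: "clopen_of (inf a b) = clopen_of a \<inter> clopen_of b"
  by (auto simp: clopen_of_def uf_inf)

lemma openin_meets_clopen:
  assumes "openin stone_space W" "W \<inter> clopen_of a \<noteq> {}"
  obtains b where "b \<le> a" "b \<noteq> bot" "clopen_of b \<subseteq> W"
proof -
  obtain q where q: "q \<in> W" "q \<in> clopen_of a" using assms by blast
  obtain c where c: "c \<in> q" "clopen_of c \<subseteq> W" "ultrafilter_on_algebra q"
    using openin_stone_spaceE[OF assms(1) q(1)] by metis
  have "q \<in> clopen_of (inf a c)" using c q by (simp add: clopen_of_def uf_inf)
  then have "inf a c \<noteq> bot" using clopen_of_eq_empty_iff[of "inf a c"] by blast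
  moreover have "clopen_of (inf a c) \<subseteq> W" using c by (auto simp: clopen_of_inf)
  ultimately show thesis using that[of "inf a c"] by simp
qed

text \<open>
  Identities between elements of $L^0$ can be checked at points where finitely many given
  elements are all finite, since such points contain a clopen set below any nonzero
  \<open>a\<close>.
\<close>

lemma common_finite_clopen:
  assumes "finite F" "a \<noteq> bot"
  obtains b where "b \<le> a" "b \<noteq> bot" "\<And>q x. q \<in> clopen_of b \<Longrightarrow> x \<in> F \<Longrightarrow> fin x q"
proof -
  have "\<exists>b\<le>a. b \<noteq> bot \<and> (\<forall>q\<in>clopen_of b. \<forall>x\<in>F. fin x q)"
    using assms
  proof (induction F)
    case (insert x F)
    then obtain b where b: "b \<le> a" "b \<noteq> bot" "\<forall>q\<in>clopen_of b. \<forall>x\<in>F. fin x q" by blast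
    have "{q. fin x q} \<inter> clopen_of b \<noteq> {}" using fin_exists[OF b(2)] by blast
    then obtain c where c: "c \<le> b" "c \<noteq> bot" "clopen_of c \<subseteq> {q. fin x q}"
      using openin_meets_clopen[OF openin_fin] by metis
    have "c \<le> a" using b c by (metis order_trans)
    moreover have "\<forall>q\<in>clopen_of c. \<forall>x\<in>insert x F. fin x q"
      using b(3) c(3) clopen_of_mono[OF c(1)] by blast
    ultimately show ?case using c(2) by blast
  qed auto
  then show thesis using that by blast
qed

lemma l0_eqI_dense:
  assumes "\<And>a. a \<noteq> bot \<Longrightarrow> \<exists>q\<in>clopen_of a. fin x q \<and> fin y q \<and> val q x = val q y"
  shows "x = y"
proof -
  have "Rep_l0 x = Rep_l0 y"
  proof (rule extensionalityI)
    show "Rep_l0 x \<in> extensional (topspace stone_space)"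
      "Rep_l0 y \<in> extensional (topspace stone_space)"
      using Rep_l0[of x] Rep_l0[of y] by (simp_all add: L0_carrier_def C_infinity_def)
    fix q assume "q \<in> topspace (stone_space :: 'a set topology)"
    then have q: "q \<in> clopen_of top" by (simp add: topspace_stone_space clopen_of_def uf_top)
    show "Rep_l0 x q = Rep_l0 y q"
      by (rule continuous_eq_if_agree_densely[OF continuous_Rep_l0 continuous_Rep_l0 _ q])
        (use assms Rep_l0_eq_val in metis)
  qed
  then show ?thesis by (simp add: Rep_l0_inject)
qed

lemma l0_eqI:
  assumes "finite F" "\<And>q. \<forall>z\<in>F. fin z q \<Longrightarrow> fin x q \<and> fin y q \<and> val q x = val q y"
  shows "x = y"
proof (rule l0_eqI_dense)
  fix a :: 'a assume "a \<noteq> bot"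
  then obtain b where b: "b \<le> a" "b \<noteq> bot" "\<And>q z. q \<in> clopen_of b \<Longrightarrow> z \<in> F \<Longrightarrow> fin z q"
    using common_finite_clopen[OF assms(1)] by metis
  obtain q where "q \<in> clopen_of b" using b(2) clopen_of_eq_empty_iff by blast
  then show "\<exists>q\<in>clopen_of a. fin x q \<and> fin y q \<and> val q x = val q y"
    using assms(2)[of q] b(3) clopen_of_mono[OF b(1)] by blast
qed

lemma continuous_val:
  assumes "\<And>q. q \<in> D \<Longrightarrow> fin x q"
  shows "continuous_map (subtopology stone_space D) euclideanreal (\<lambda>q. val q x)"
proof -
  let ?R = "{z :: ereal. \<bar>z\<bar> \<noteq> \<infinity>}"
  have "continuous_on ?R real_of_ereal"
    using continuous_on_iff_real[of ?R "\<lambda>z. z"] continuous_on_id by (auto simp: comp_def)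
  then have "continuous_map (top_of_set ?R) euclideanreal real_of_ereal" by simp
  moreover have "continuous_map (subtopology stone_space D) (top_of_set ?R) (Rep_l0 x)"
    unfolding continuous_map_in_subtopology
    using continuous_map_from_subtopology[OF continuous_Rep_l0[of x]] assms
    by (auto simp: fin_def)
  ultimately have "continuous_map (subtopology stone_space D) euclideanreal (real_of_ereal \<circ> Rep_l0 x)"
    using continuous_map_compose by metis
  then show ?thesis by (simp add: comp_def val_def[abs_def])
qed

lemma extend_dense_val:
  assumes D: "openin stone_space D" "\<And>a. a \<noteq> bot \<Longrightarrow> D \<inter> clopen_of a \<noteq> {}"
    and h: "continuous_map (subtopology stone_space D) euclideanreal h" "\<And>q. q \<in> D \<Longrightarrow> f q = ereal (h q)"
  shows "extend_dense stone_space f \<in> L0_carrier"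
    and "q \<in> D \<Longrightarrow> fin (Abs_l0 (extend_dense stone_space f)) q \<and>
      val q (Abs_l0 (extend_dense stone_space f)) = h q"
proof -
  have "continuous_map euclideanreal euclidean ereal" by (simp add: continuous_on_ereal)
  then have "continuous_map (subtopology stone_space D) euclidean (ereal \<circ> h)"
    using continuous_map_compose h(1) by blast
  then have c: "continuous_map (subtopology stone_space D) euclidean f"
    by (rule continuous_map_eq) (simp add: h)
  note ext = extend_dense_correct[OF D c]
  show 1: "extend_dense stone_space f \<in> L0_carrier"
    unfolding L0_carrier_def by (rule ext) (auto simp: h(2))
  show "fin (Abs_l0 (extend_dense stone_space f)) q \<and>
      val q (Abs_l0 (extend_dense stone_space f)) = h q" if q: "q \<in> D"
  proof -
    have "ultrafilter_on_algebra q" using D(1) q openin_stone_space_iff by blast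
    moreover have "extend_dense stone_space f q = f q" by (rule ext(2)) (use q h(2) in auto)
    ultimately show ?thesis
      using Abs_l0_inverse[OF 1] h(2)[OF q] by (simp add: fin_def val_def)
  qed
qed

lemma both_finite_open_dense:
  shows "openin stone_space {q. fin x q \<and> fin y q}"
    and "a \<noteq> bot \<Longrightarrow> {q. fin x q \<and> fin y q} \<inter> clopen_of a \<noteq> {}"
proof -
  show "openin stone_space {q. fin x q \<and> fin y q}"
    using openin_Int[OF openin_fin[of x] openin_fin[of y]] by (simp add: Collect_conj_eq)
  assume "a \<noteq> bot"
  then obtain b where b: "b \<le> a" "b \<noteq> bot" "\<And>q z. q \<in> clopen_of b \<Longrightarrow> z \<in> {x, y} \<Longrightarrow> fin z q"
    using common_finite_clopen[of "{x, y}"] by (metis finite.emptyI finite.insertI)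
  obtain q where "q \<in> clopen_of b" using b(2) clopen_of_eq_empty_iff by blast
  then show "{q. fin x q \<and> fin y q} \<inter> clopen_of a \<noteq> {}"
    using b(3) clopen_of_mono[OF b(1)] by blast
qed

lemma L0_add_Rep:
  shows "L0_add (Rep_l0 x) (Rep_l0 y) \<in> L0_carrier"
    and "fin x q \<Longrightarrow> fin y q \<Longrightarrow> fin (Abs_l0 (L0_add (Rep_l0 x) (Rep_l0 y))) q \<and>
      val q (Abs_l0 (L0_add (Rep_l0 x) (Rep_l0 y))) = val q x + val q y"
proof -
  have c: "continuous_map (subtopology stone_space {q. fin x q \<and> fin y q}) euclideanreal
      (\<lambda>q. val q x + val q y)"
    by (intro continuous_map_add continuous_val) auto
  have f: "Rep_l0 x q + Rep_l0 y q = ereal (val q x + val q y)" if "q \<in> {q. fin x q \<and> fin y q}" for q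
    using that by (simp add: Rep_l0_eq_val)
  show "L0_add (Rep_l0 x) (Rep_l0 y) \<in> L0_carrier"
    unfolding L0_add_def by (rule extend_dense_val(1)[OF both_finite_open_dense c f])
  show "fin (Abs_l0 (L0_add (Rep_l0 x) (Rep_l0 y))) q \<and>
      val q (Abs_l0 (L0_add (Rep_l0 x) (Rep_l0 y))) = val q x + val q y" if "fin x q" "fin y q"
    unfolding L0_add_def using that by (intro extend_dense_val(2)[OF both_finite_open_dense c f]) auto
qed

lemma L0_mult_Rep:
  shows "L0_mult (Rep_l0 x) (Rep_l0 y) \<in> L0_carrier"
    and "fin x q \<Longrightarrow> fin y q \<Longrightarrow> fin (Abs_l0 (L0_mult (Rep_l0 x) (Rep_l0 y))) q \<and>
      val q (Abs_l0 (L0_mult (Rep_l0 x) (Rep_l0 y))) = val q x * val q y"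
proof -
  have c: "continuous_map (subtopology stone_space {q. fin x q \<and> fin y q}) euclideanreal
      (\<lambda>q. val q x * val q y)"
    by (intro continuous_map_real_mult continuous_val) auto
  have f: "Rep_l0 x q * Rep_l0 y q = ereal (val q x * val q y)" if "q \<in> {q. fin x q \<and> fin y q}" for q
    using that by (simp add: Rep_l0_eq_val)
  show "L0_mult (Rep_l0 x) (Rep_l0 y) \<in> L0_carrier"
    unfolding L0_mult_def by (rule extend_dense_val(1)[OF both_finite_open_dense c f])
  show "fin (Abs_l0 (L0_mult (Rep_l0 x) (Rep_l0 y))) q \<and>
      val q (Abs_l0 (L0_mult (Rep_l0 x) (Rep_l0 y))) = val q x * val q y" if "fin x q" "fin y q"
    unfolding L0_mult_def using that by (intro extend_dense_val(2)[OF both_finite_open_dense c f]) auto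
qed

lemma L0_scale_Rep:
  shows "L0_scale c (Rep_l0 x) \<in> L0_carrier"
    and "fin x q \<Longrightarrow> fin (Abs_l0 (L0_scale c (Rep_l0 x))) q \<and>
      val q (Abs_l0 (L0_scale c (Rep_l0 x))) = c * val q x"
proof -
  have c: "continuous_map (subtopology stone_space {q. fin x q \<and> fin x q}) euclideanreal
      (\<lambda>q. c * val q x)"
    by (intro continuous_map_real_mult continuous_val) auto
  have f: "ereal c * Rep_l0 x q = ereal (c * val q x)" if "q \<in> {q. fin x q \<and> fin x q}" for q
    using that by (simp add: Rep_l0_eq_val)
  show "L0_scale c (Rep_l0 x) \<in> L0_carrier"
    unfolding L0_scale_def by (rule extend_dense_val(1)[OF both_finite_open_dense c f])
  show "fin (Abs_l0 (L0_scale c (Rep_l0 x))) q \<and>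
      val q (Abs_l0 (L0_scale c (Rep_l0 x))) = c * val q x" if "fin x q"
    unfolding L0_scale_def using that by (intro extend_dense_val(2)[OF both_finite_open_dense c f]) auto
qed

lemma L0_zero_Rep:
  "ultrafilter_on_algebra q \<Longrightarrow> fin (Abs_l0 L0_zero) q \<and> val q (Abs_l0 L0_zero) = 0"
  unfolding fin_def val_def Abs_l0_inverse[OF L0_zero_in_carrier]
  by (simp add: L0_zero_def topspace_stone_space)

instantiation l0 :: ("{boolean_algebra,complete_lattice}") "{comm_ring, real_algebra}"
begin

definition zero_l0 :: "'a l0" where "zero_l0 = Abs_l0 L0_zero"
definition plus_l0 :: "'a l0 \<Rightarrow> 'a l0 \<Rightarrow> 'a l0" where
  "plus_l0 x y = Abs_l0 (L0_add (Rep_l0 x) (Rep_l0 y))"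
definition times_l0 :: "'a l0 \<Rightarrow> 'a l0 \<Rightarrow> 'a l0" where
  "times_l0 x y = Abs_l0 (L0_mult (Rep_l0 x) (Rep_l0 y))"
definition scaleR_l0 :: "real \<Rightarrow> 'a l0 \<Rightarrow> 'a l0" where
  "scaleR_l0 c x = Abs_l0 (L0_scale c (Rep_l0 x))"
definition uminus_l0 :: "'a l0 \<Rightarrow> 'a l0" where "uminus_l0 x = (-1) *\<^sub>R x"
definition minus_l0 :: "'a l0 \<Rightarrow> 'a l0 \<Rightarrow> 'a l0" where "minus_l0 x y = x + - y"

lemma fin_ops:
  "ultrafilter_on_algebra q \<Longrightarrow> fin (0 :: 'a l0) q"
  "fin x q \<Longrightarrow> fin y q \<Longrightarrow> fin (x + y) q"
  "fin x q \<Longrightarrow> fin y q \<Longrightarrow> fin (x * y) q"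
  "fin x q \<Longrightarrow> fin (c *\<^sub>R x) q"
  "fin x q \<Longrightarrow> fin (- x) q"
  "fin x q \<Longrightarrow> fin y q \<Longrightarrow> fin (x - y) q"
  for x y :: "'a l0"
  unfolding zero_l0_def plus_l0_def times_l0_def scaleR_l0_def uminus_l0_def minus_l0_def
  by (simp_all add: L0_zero_Rep L0_add_Rep L0_mult_Rep L0_scale_Rep)

lemma val_ops:
  "ultrafilter_on_algebra q \<Longrightarrow> val q (0 :: 'a l0) = 0"
  "fin x q \<Longrightarrow> fin y q \<Longrightarrow> val q (x + y) = val q x + val q y"
  "fin x q \<Longrightarrow> fin y q \<Longrightarrow> val q (x * y) = val q x * val q y"
  "fin x q \<Longrightarrow> val q (c *\<^sub>R x) = c * val q x"
  "fin x q \<Longrightarrow> val q (- x) = - val q x"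
  "fin x q \<Longrightarrow> fin y q \<Longrightarrow> val q (x - y) = val q x - val q y"
  for x y :: "'a l0"
  unfolding zero_l0_def plus_l0_def times_l0_def scaleR_l0_def uminus_l0_def minus_l0_def
  by (simp_all add: L0_zero_Rep L0_add_Rep L0_mult_Rep L0_scale_Rep)

instance
proof
  fix x y z :: "'a l0" and c d :: real
  note ops = fin_ops val_ops fin_uf algebra_simps
  show "x * y * z = x * (y * z)" by (rule l0_eqI[of "{x, y, z}"]) (auto simp: ops)
  show "x * y = y * x" by (rule l0_eqI[of "{x, y, z}"]) (auto simp: ops)
  show "x + y + z = x + (y + z)" by (rule l0_eqI[of "{x, y, z}"]) (auto simp: ops)
  show "x + y = y + x" by (rule l0_eqI[of "{x, y, z}"]) (auto simp: ops)
  show "0 + x = x" by (rule l0_eqI[of "{x, y, z}"]) (auto simp: ops)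
  show "- x + x = 0" by (rule l0_eqI[of "{x, y, z}"]) (auto simp: ops)
  show "x - y = x + - y" by (rule l0_eqI[of "{x, y, z}"]) (auto simp: ops)
  show "(x + y) * z = x * z + y * z" by (rule l0_eqI[of "{x, y, z}"]) (auto simp: ops)
  show "x * (y + z) = x * y + x * z" by (rule l0_eqI[of "{x, y, z}"]) (auto simp: ops)
  show "c *\<^sub>R (x + y) = c *\<^sub>R x + c *\<^sub>R y" by (rule l0_eqI[of "{x, y, z}"]) (auto simp: ops)
  show "(c + d) *\<^sub>R x = c *\<^sub>R x + d *\<^sub>R x" by (rule l0_eqI[of "{x, y, z}"]) (auto simp: ops)
  show "c *\<^sub>R d *\<^sub>R x = (c * d) *\<^sub>R x" by (rule l0_eqI[of "{x, y, z}"]) (auto simp: ops)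
  show "1 *\<^sub>R x = x" by (rule l0_eqI[of "{x, y, z}"]) (auto simp: ops)
  show "c *\<^sub>R x * y = c *\<^sub>R (x * y)" by (rule l0_eqI[of "{x, y, z}"]) (auto simp: ops)
  show "x * c *\<^sub>R y = c *\<^sub>R (x * y)" by (rule l0_eqI[of "{x, y, z}"]) (auto simp: ops)
qed

end

lemma Rep_l0_ops:
  "Rep_l0 0 = L0_zero"
  "Rep_l0 (x + y) = L0_add (Rep_l0 x) (Rep_l0 y)"
  "Rep_l0 (x * y) = L0_mult (Rep_l0 x) (Rep_l0 y)"
  "Rep_l0 (c *\<^sub>R x) = L0_scale c (Rep_l0 x)"
  by (simp_all add: zero_l0_def plus_l0_def times_l0_def scaleR_l0_def Abs_l0_inverse
      L0_zero_in_carrier L0_add_Rep L0_mult_Rep L0_scale_Rep)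

definition of_continuous :: "('b set \<Rightarrow> real) \<Rightarrow> 'b::{boolean_algebra,complete_lattice} l0" where
  "of_continuous h = Abs_l0 (\<lambda>q\<in>topspace stone_space. ereal (h q))"

lemma of_continuous_props:
  assumes "continuous_map stone_space euclideanreal h"
  shows "Rep_l0 (of_continuous h) = (\<lambda>q\<in>topspace stone_space. ereal (h q))"
    and "ultrafilter_on_algebra q \<Longrightarrow> fin (of_continuous h) q"
    and "ultrafilter_on_algebra q \<Longrightarrow> val q (of_continuous h) = h q"
    and "Rep_l0 (of_continuous h) \<in> CQ_carrier"
proof -
  let ?f = "\<lambda>q\<in>topspace stone_space. ereal (h q)"
  have "continuous_map euclideanreal euclidean ereal" by (simp add: continuous_on_ereal)
  then have "continuous_map stone_space euclidean (ereal \<circ> h)"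
    using continuous_map_compose assms by blast
  then have "continuous_map stone_space euclidean ?f"
    by (rule continuous_map_eq) simp
  moreover have "\<exists>q\<in>clopen_of a. \<bar>?f q\<bar> \<noteq> \<infinity>" if "a \<noteq> bot" for a
    using that clopen_of_eq_empty_iff[of a] by (auto simp: clopen_of_def topspace_stone_space)
  ultimately have f: "?f \<in> C_infinity stone_space"
    unfolding C_infinity_stone_space_iff by auto
  then show 1: "Rep_l0 (of_continuous h) = ?f"
    unfolding of_continuous_def by (simp add: Abs_l0_inverse L0_carrier_def)
  show "ultrafilter_on_algebra q \<Longrightarrow> fin (of_continuous h) q"
    "ultrafilter_on_algebra q \<Longrightarrow> val q (of_continuous h) = h q"
    by (simp_all add: fin_def val_def 1 topspace_stone_space)
  show "Rep_l0 (of_continuous h) \<in> CQ_carrier"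
    unfolding 1 CQ_carrier_def C_real_def using f by auto
qed

definition ind :: "'b::{boolean_algebra,complete_lattice} \<Rightarrow> 'b l0" where
  "ind e = of_continuous (\<lambda>q. of_bool (e \<in> q))"

lemma continuous_indicator:
  "continuous_map stone_space euclideanreal (\<lambda>q. of_bool (e \<in> q))"
proof (rule continuous_map_linorder)
  fix c :: real
  have "{q \<in> topspace stone_space. of_bool (e \<in> q) < c} =
      (if 1 < c then clopen_of top else if 0 < c then clopen_of (- e) else {})"
    by (auto simp: topspace_stone_space clopen_of_def uf_top uf_compl)
  then show "openin stone_space {q \<in> topspace stone_space. of_bool (e \<in> q) < c}"
    using openin_clopen_of by auto
  have "{q \<in> topspace stone_space. c < of_bool (e \<in> q)} =
      (if c < 0 then clopen_of top else if c < 1 then clopen_of e else {})"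
    by (auto simp: topspace_stone_space clopen_of_def uf_top uf_compl)
  then show "openin stone_space {q \<in> topspace stone_space. c < of_bool (e \<in> q)}"
    using openin_clopen_of by auto
qed

lemma fin_ind: "ultrafilter_on_algebra q \<Longrightarrow> fin (ind e) q"
  and val_ind: "ultrafilter_on_algebra q \<Longrightarrow> val q (ind e) = of_bool (e \<in> q)"
  and Rep_ind: "Rep_l0 (ind e) = L0_idempotent e"
  unfolding ind_def L0_idempotent_def of_continuous_props(1)[OF continuous_indicator]
  by (simp_all add: of_continuous_props[OF continuous_indicator] fun_eq_iff restrict_def)

lemmas l0_simps = fin_ops val_ops fin_ind val_ind fin_uf

lemma ind_top: "ind top * x = x"
  by (rule l0_eqI[of "{x}"]) (auto simp: l0_simps uf_top)

lemma ind_inf: "ind a * ind b = ind (inf a b)"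
  by (rule l0_eqI[of "{0}"]) (auto simp: l0_simps uf_inf)

lemma ind_compl: "ind (- a) = ind top - ind a"
  by (rule l0_eqI[of "{0}"]) (auto simp: l0_simps uf_compl uf_top)

text \<open>
  Multiplication by an idempotent is restriction to a clopen set. The values at infinite points
  agree too, by continuity.
\<close>

lemma ind_mult_eq_iff:
  "ind a * x = ind a * y \<longleftrightarrow> (\<forall>q\<in>clopen_of a. Rep_l0 x q = Rep_l0 y q)"
proof
  assume eq: "ind a * x = ind a * y"
  show "\<forall>q\<in>clopen_of a. Rep_l0 x q = Rep_l0 y q"
  proof
    fix q assume q: "q \<in> clopen_of a"
    show "Rep_l0 x q = Rep_l0 y q"
    proof (rule continuous_eq_if_agree_densely[OF continuous_Rep_l0 continuous_Rep_l0 _ q])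
      fix b assume b: "b \<noteq> bot" "b \<le> a"
      obtain p where p: "p \<in> clopen_of b" "fin x p" "fin y p"
        using both_finite_open_dense(2)[OF b(1), of x y] by blast
      have "a \<in> p" "ultrafilter_on_algebra p"
        using p(1) clopen_of_mono[OF b(2)] by (auto simp: clopen_of_def)
      then have "val p x = val p (ind a * x)" "val p y = val p (ind a * y)"
        using p by (simp_all add: l0_simps)
      then show "\<exists>q\<in>clopen_of b. Rep_l0 x q = Rep_l0 y q"
        using eq p by (metis Rep_l0_eq_val)
    qed
  qed
next
  assume *: "\<forall>q\<in>clopen_of a. Rep_l0 x q = Rep_l0 y q"
  show "ind a * x = ind a * y"
  proof (rule l0_eqI[of "{x, y}"])
    fix q assume q: "\<forall>z\<in>{x, y}. fin z q"
    then have "a \<in> q \<Longrightarrow> val q x = val q y"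
      using * fin_uf[of x q] by (simp add: val_def clopen_of_def)
    then show "fin (ind a * x) q \<and> fin (ind a * y) q \<and> val q (ind a * x) = val q (ind a * y)"
      using q by (auto simp: l0_simps)
  qed simp
qed

lemma ind_mult_eq_0_iff: "ind a * x = 0 \<longleftrightarrow> (\<forall>q\<in>clopen_of a. Rep_l0 x q = 0)"
proof -
  have "Rep_l0 0 q = 0" if "q \<in> clopen_of a" for q
    using that by (simp add: Rep_l0_ops L0_zero_def topspace_stone_space clopen_of_def)
  then show ?thesis using ind_mult_eq_iff[of a x 0] by simp
qed

lemma ind_eq_0_iff: "ind a = 0 \<longleftrightarrow> a = bot"
proof -
  have "ind a = 0 \<longleftrightarrow> ind a * ind top = 0" by (metis ind_top mult.commute)
  also have "\<dots> \<longleftrightarrow> clopen_of a = {}"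
    by (auto simp: ind_mult_eq_0_iff Rep_ind L0_idempotent_def clopen_of_def topspace_stone_space uf_top)
  finally show ?thesis by (simp add: clopen_of_eq_empty_iff)
qed

abbreviation supp :: "'b::{boolean_algebra,complete_lattice} l0 \<Rightarrow> 'b" where
  "supp x \<equiv> L0_support (Rep_l0 x)"

lemma supp_eq: "supp x = - Sup {e. ind e * x = 0}"
  unfolding L0_support_def Rep_ind[symmetric] Rep_l0_ops[symmetric] Rep_l0_inject ..

text \<open>
  The supremum in the definition of the support is attained: a continuous function that vanishes
  on a union of clopen sets vanishes on its closure.
\<close>

lemma ind_mult_eq_0_iff_le: "ind e * x = 0 \<longleftrightarrow> e \<le> - supp x"
proof
  assume "ind e * x = 0"
  then show "e \<le> - supp x" by (simp add: supp_eq Sup_upper)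
next
  let ?S = "{e. ind e * x = 0}"
  assume e: "e \<le> - supp x"
  have "ind (Sup ?S) * x = ind (Sup ?S) * 0"
    unfolding ind_mult_eq_iff
  proof
    fix q assume q: "q \<in> clopen_of (Sup ?S)"
    show "Rep_l0 x q = Rep_l0 0 q"
    proof (rule continuous_eq_if_agree_densely[OF continuous_Rep_l0 continuous_Rep_l0 _ q])
      fix b assume b: "b \<noteq> bot" "b \<le> Sup ?S"
      then have "inf b (Sup ?S) \<noteq> bot" by (simp add: inf.absorb1)
      then obtain c where c: "c \<in> ?S" "inf b c \<noteq> bot" using inf_Sup_eq_bot by metis
      obtain p where p: "p \<in> clopen_of (inf b c)" using c clopen_of_eq_empty_iff by blast
      have "\<forall>q\<in>clopen_of c. Rep_l0 x q = Rep_l0 0 q"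
        using c ind_mult_eq_iff[of c x 0] by simp
      then show "\<exists>q\<in>clopen_of b. Rep_l0 x q = Rep_l0 0 q"
        using p by (auto simp: clopen_of_inf)
    qed
  qed
  then have "\<forall>q\<in>clopen_of (Sup ?S). Rep_l0 x q = 0" by (simp add: ind_mult_eq_0_iff)
  moreover have "clopen_of e \<subseteq> clopen_of (Sup ?S)"
    using e by (intro clopen_of_mono) (simp add: supp_eq)
  ultimately show "ind e * x = 0" unfolding ind_mult_eq_0_iff by blast
qed

lemma ind_supp_mult: "ind (supp x) * x = x"
proof -
  have "ind (- supp x) * x = 0" by (simp add: ind_mult_eq_0_iff_le)
  then show ?thesis by (simp add: ind_compl left_diff_distrib ind_top)
qed

lemma supp_eq_bot_iff: "supp x = bot \<longleftrightarrow> x = 0"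
proof -
  have "x = 0 \<longleftrightarrow> - supp x = top"
    using ind_mult_eq_0_iff_le[of top x] by (simp add: ind_top top_unique)
  then show ?thesis by (metis compl_bot_eq double_compl)
qed

lemma not_vanishing_below_supp:
  assumes "a \<le> supp x" "a \<noteq> bot"
  obtains b where "b \<le> a" "b \<noteq> bot" "\<And>q. q \<in> clopen_of b \<Longrightarrow> Rep_l0 x q \<noteq> 0"
proof -
  have "\<not> a \<le> - supp x"
  proof
    assume "a \<le> - supp x"
    then have "a \<le> inf (supp x) (- supp x)" using assms(1) by (rule le_infI[rotated])
    then show False using assms(2) by (metis bot_unique inf_compl_bot)
  qed
  then obtain q where q: "q \<in> clopen_of a" "Rep_l0 x q \<noteq> 0"
    unfolding ind_mult_eq_0_iff_le[symmetric] ind_mult_eq_0_iff by blast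
  let ?W = "{q. ultrafilter_on_algebra q \<and> Rep_l0 x q \<in> - {0}}"
  have "openin stone_space ?W" by (rule openin_Rep_l0_vimage) (intro open_Compl closed_singleton)
  moreover have "?W \<inter> clopen_of a \<noteq> {}" using q by (auto simp: clopen_of_def)
  ultimately obtain b where "b \<le> a" "b \<noteq> bot" "clopen_of b \<subseteq> ?W"
    by (rule openin_meets_clopen)
  then show thesis using that[of b] by blast
qed

text \<open>
  If the supports met, there would be a clopen set on which neither factor vanishes, and at a
  point where both are finite their product would be nonzero.
\<close>

lemma supp_disjoint_if_mult_eq_0:
  assumes "r * t = 0"
  shows "ind (supp r) * t = 0"
proof -
  have "inf (supp r) (supp t) = bot"
  proof (rule ccontr)
    assume "inf (supp r) (supp t) \<noteq> bot"
    then obtain b where b: "b \<le> inf (supp r) (supp t)" "b \<noteq> bot"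
      "\<And>q. q \<in> clopen_of b \<Longrightarrow> Rep_l0 r q \<noteq> 0"
      using not_vanishing_below_supp[of "inf (supp r) (supp t)" r] by auto
    obtain c where c: "c \<le> b" "c \<noteq> bot" "\<And>q. q \<in> clopen_of c \<Longrightarrow> Rep_l0 t q \<noteq> 0"
      using not_vanishing_below_supp[of b t] b by auto
    obtain q where q: "q \<in> clopen_of c" "fin r q" "fin t q"
      using both_finite_open_dense(2)[OF c(2), of r t] by blast
    have "Rep_l0 r q \<noteq> 0" "Rep_l0 t q \<noteq> 0"
      using q(1) b(3) c(3) clopen_of_mono[OF c(1)] by blast+
    then have "val q r \<noteq> 0" "val q t \<noteq> 0"
      using q by (simp_all add: Rep_l0_eq_val)
    moreover have "val q r * val q t = 0"
      using assms q val_ops(3)[of r q t] by (simp add: val_ops fin_uf)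
    ultimately show False by simp
  qed
  then show ?thesis by (simp add: ind_mult_eq_0_iff_le inf_shunt)
qed

text \<open>
  Where \<open>r\<close> is nonzero, the solution has to be \<open>s / r\<close>.
  Compatibility makes these quotients agree on overlaps, so they paste to a continuous function
  on the open set \<open>U\<close> of the points where, for some equation, \<open>r\<close> and
  \<open>s\<close> are finite and \<open>r\<close> is nonzero. On the interior of the complement
  all equations read \<open>0 = 0\<close>, and the value 0 is chosen there. The result is
  defined on a dense open set and extends.
\<close>

lemma linear_system_solvable:
  fixes M :: "('b::{boolean_algebra,complete_lattice} l0 \<times> 'b l0) set"
  assumes compat: "\<And>r s r' s'. (r, s) \<in> M \<Longrightarrow> (r', s') \<in> M \<Longrightarrow> r * s' = r' * s"
    and van: "\<And>r s t. (r, s) \<in> M \<Longrightarrow> r * t = 0 \<Longrightarrow> s * t = 0"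
  shows "\<exists>y. \<forall>(r, s)\<in>M. y * r = s"
proof -
  define W where "W = (\<lambda>(r :: 'b l0, s :: 'b l0). {q. fin r q \<and> fin s q \<and> val q r \<noteq> 0})"
  define U where "U = (\<Union>m\<in>M. W m)"
  define V where "V = topspace stone_space - stone_space closure_of U"
  have W_open: "openin stone_space (W m)" for m
  proof -
    have "W m = {q. fin (fst m) q \<and> fin (snd m) q} \<inter>
        {q. ultrafilter_on_algebra q \<and> Rep_l0 (fst m) q \<in> - {0}}"
      by (auto simp: W_def fin_uf Rep_l0_eq_val split: prod.splits)
    moreover have "openin stone_space {q. ultrafilter_on_algebra q \<and> Rep_l0 (fst m) q \<in> - {0}}"
      by (rule openin_Rep_l0_vimage) (intro open_Compl closed_singleton)
    ultimately show ?thesis using both_finite_open_dense(1)[of "fst m" "snd m"] by auto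
  qed
  have U_open: "openin stone_space U" unfolding U_def using W_open by blast
  have V_open: "openin stone_space V" unfolding V_def by (simp add: openin_diff)
  have UV: "U \<inter> V = {}"
    using closure_of_subset[OF openin_subset[OF U_open]] by (auto simp: V_def)
  define D where "D = U \<union> V"
  have D: "openin stone_space D" unfolding D_def using U_open V_open by blast
  have D_dense: "D \<inter> clopen_of a \<noteq> {}" if "a \<noteq> bot" for a
  proof (cases "U \<inter> clopen_of a = {}")
    case True
    obtain q where q: "q \<in> clopen_of a" using clopen_of_eq_empty_iff[of a] \<open>a \<noteq> bot\<close> by blast
    have "clopen_of a \<inter> stone_space closure_of U = {}"
      unfolding openin_Int_closure_of_eq_empty[OF openin_clopen_of] using True by blast
    then have "q \<notin> stone_space closure_of U" using q by blast
    then have "q \<in> V" using q by (simp add: V_def topspace_stone_space clopen_of_def)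
    then show ?thesis using q D_def by blast
  qed (auto simp: D_def)
  let ?X = "subtopology stone_space D"
  \<comment> \<open>The index \<open>None\<close> stands for the region \<open>V\<close>, where the
    solution is set to 0.\<close>
  define T where "T i = (case i of None \<Rightarrow> V | Some m \<Rightarrow> W m)" for i
  define f where "f i q = (case i of None \<Rightarrow> 0 | Some (r, s) \<Rightarrow> val q s / val q r)"
    for i :: "('b l0 \<times> 'b l0) option" and q
  obtain h where h: "continuous_map ?X euclideanreal h"
    "\<And>i q. i \<in> insert None (Some ` M) \<Longrightarrow> q \<in> topspace ?X \<inter> T i \<Longrightarrow> h q = f i q"
  proof (rule pasting_lemma_exists[where X = ?X and Y = euclideanreal and
        I = "insert None (Some ` M)" and T = T and f = f])
    show "topspace ?X \<subseteq> (\<Union>i\<in>insert None (Some ` M). T i)"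
      by (auto simp: D_def U_def T_def)
    show "openin ?X (T i)" if "i \<in> insert None (Some ` M)" for i
      using that D V_open W_open by (auto simp: openin_open_subtopology T_def D_def U_def)
    show "continuous_map (subtopology ?X (T i)) euclideanreal (f i)"
      if "i \<in> insert None (Some ` M)" for i
    proof (cases i)
      case (Some m)
      have "continuous_map (subtopology stone_space (D \<inter> W m)) euclideanreal
          (\<lambda>q. val q (snd m) / val q (fst m))"
        by (intro continuous_map_real_divide continuous_val) (auto simp: W_def split: prod.splits)
      then show ?thesis by (simp add: Some T_def f_def[abs_def] subtopology_subtopology case_prod_unfold)
    qed (simp add: f_def[abs_def])
    show "f i q = f j q" if ij: "i \<in> insert None (Some ` M)" "j \<in> insert None (Some ` M)"
      "q \<in> topspace ?X \<inter> T i \<inter> T j" for i j q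
    proof (cases i; cases j)
      fix m m' assume ms: "i = Some m" "j = Some m'"
      obtain r s r' s' where m: "m = (r, s)" "m' = (r', s')" by fastforce
      have M: "(r, s) \<in> M" "(r', s') \<in> M" using ij ms m by auto
      have fins: "fin r q" "fin s q" "fin r' q" "fin s' q" "val q r \<noteq> 0" "val q r' \<noteq> 0"
        using ij(3) by (auto simp: ms m T_def W_def)
      have "val q r * val q s' = val q r' * val q s"
        using arg_cong[OF compat[OF M], of "val q"] fins by (simp add: val_ops)
      then show ?thesis using fins by (simp add: ms m f_def field_simps)
    qed (use ij UV in \<open>auto simp: T_def U_def\<close>)
  qed blast
  define y where "y = Abs_l0 (extend_dense stone_space (\<lambda>q. ereal (h q)))"
  have y: "fin y q \<and> val q y = h q" if "q \<in> D" for q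
    unfolding y_def by (rule extend_dense_val(2)[OF D D_dense h(1)]) (use that in auto)
  have "y * r = s" if M: "(r, s) \<in> M" for r s
  proof (rule l0_eqI_dense)
    fix a :: 'b assume "a \<noteq> bot"
    then obtain b where b: "b \<le> a" "b \<noteq> bot" "\<And>q z. q \<in> clopen_of b \<Longrightarrow> z \<in> {r, s, y} \<Longrightarrow> fin z q"
      using common_finite_clopen[of "{r, s, y}"] by (metis finite.emptyI finite.insertI)
    have "\<exists>q\<in>clopen_of b. val q y * val q r = val q s"
    proof (cases "ind b * r = 0")
      case True
      then have "ind b * s = 0" using van[OF M, of "ind b"] by (simp add: mult.commute)
      then have "\<forall>q\<in>clopen_of b. val q r = 0 \<and> val q s = 0"
        using True by (simp add: ind_mult_eq_0_iff val_def)
      moreover obtain q where "q \<in> clopen_of b" using b(2) clopen_of_eq_empty_iff by blast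
      ultimately show ?thesis by auto
    next
      case False
      then obtain q where q: "q \<in> clopen_of b" "Rep_l0 r q \<noteq> 0" unfolding ind_mult_eq_0_iff by blast
      then have "val q r \<noteq> 0" "fin r q" "fin s q" using b(3) by (auto simp: Rep_l0_eq_val)
      then have qW: "q \<in> W (r, s)" by (simp add: W_def)
      then have qD: "q \<in> D" using M by (auto simp: D_def U_def)
      have "h q = val q s / val q r"
        using h(2)[of "Some (r, s)" q] M qW qD openin_subset[OF D]
        by (auto simp: T_def f_def)
      then show ?thesis using y[OF qD] \<open>val q r \<noteq> 0\<close> q(1) by (intro bexI[of _ q]) auto
    qed
    then obtain q where q: "q \<in> clopen_of b" "val q y * val q r = val q s" by blast
    then show "\<exists>q\<in>clopen_of a. fin (y * r) q \<and> fin s q \<and> val q (y * r) = val q s"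
      using b(3)[OF q(1)] clopen_of_mono[OF b(1)] by (intro bexI[of _ q]) (auto simp: l0_simps)
  qed
  then show ?thesis by blast
qed

interpretation L0: saturated_algebra "range ind" "ind (top :: 'b::{boolean_algebra,complete_lattice})"
proof
  show "ind top \<in> range ind" by blast
  show "ind top * x = x" for x :: "'b l0" by (rule ind_top)
  show "e * e = e" if "e \<in> range ind" for e :: "'b l0" using that by (auto simp: ind_inf)
  show "\<exists>e\<in>range ind. e * r = r \<and> (\<forall>t. r * t = 0 \<longrightarrow> e * t = 0)" for r :: "'b l0"
    using ind_supp_mult[of r] supp_disjoint_if_mult_eq_0[of r] by blast
qed (rule linear_system_solvable)

section \<open>Constancy on clopen sets and distributivity\<close>

definition constant_below :: "'b::{boolean_algebra,complete_lattice} l0 \<Rightarrow> 'b \<Rightarrow> bool" where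
  "constant_below x a \<longleftrightarrow> (\<exists>c. ind a * x = c *\<^sub>R ind a)"

lemma constant_below_iff: "constant_below x a \<longleftrightarrow> (\<exists>c. \<forall>q\<in>clopen_of a. Rep_l0 x q = ereal c)"
proof -
  have "c *\<^sub>R ind a = ind a * (c *\<^sub>R ind top)" for c
    by (metis ind_top mult.commute mult_scaleR_right)
  moreover have "Rep_l0 (c *\<^sub>R ind top) q = ereal c" if "q \<in> clopen_of a" for c q
    using that Rep_l0_eq_val[of "c *\<^sub>R ind top" q] by (simp add: clopen_of_def l0_simps uf_top)
  ultimately have "ind a * x = c *\<^sub>R ind a \<longleftrightarrow> (\<forall>q\<in>clopen_of a. Rep_l0 x q = ereal c)" for c
    using ind_mult_eq_iff[of a x "c *\<^sub>R ind top"] by metis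
  then show ?thesis unfolding constant_below_def by simp
qed

lemma constant_below_mono: "constant_below x b \<Longrightarrow> a \<le> b \<Longrightarrow> constant_below x a"
  unfolding constant_below_iff using clopen_of_mono by blast

lemma constant_below_ops:
  assumes "constant_below x a" "constant_below y a"
  shows "constant_below (x + y) a" "constant_below (x * y) a" "constant_below (c *\<^sub>R x) a"
proof -
  obtain d where d: "ind a * x = d *\<^sub>R ind a" using assms(1) unfolding constant_below_def by blast
  obtain e where e: "ind a * y = e *\<^sub>R ind a" using assms(2) unfolding constant_below_def by blast
  have "ind a * (x + y) = (d + e) *\<^sub>R ind a" by (simp add: d e distrib_left scaleR_add_left)
  then show "constant_below (x + y) a" unfolding constant_below_def by blast
  have "ind a * (c *\<^sub>R x) = (c * d) *\<^sub>R ind a" by (simp add: d)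
  then show "constant_below (c *\<^sub>R x) a" unfolding constant_below_def by blast
  have "ind a * (x * y) = d *\<^sub>R ind a * y" using d by (simp add: mult.assoc[symmetric])
  also have "\<dots> = (d * e) *\<^sub>R ind a" by (simp add: e)
  finally show "constant_below (x * y) a" unfolding constant_below_def by blast
qed

text \<open>
  These elements form the algebra of all mixings of real constants. It plays the part of the
  ground field: derivations vanish on it.
\<close>

definition locally_constant :: "'b::{boolean_algebra,complete_lattice} l0 \<Rightarrow> bool" where
  "locally_constant x \<longleftrightarrow> (\<forall>a. a \<noteq> bot \<longrightarrow> (\<exists>b\<le>a. b \<noteq> bot \<and> constant_below x b))"

lemma locally_constant_common:
  assumes "locally_constant x" "locally_constant y" "a \<noteq> bot"
  obtains b where "b \<le> a" "b \<noteq> bot" "constant_below x b" "constant_below y b"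
proof -
  obtain b where b: "b \<le> a" "b \<noteq> bot" "constant_below x b"
    using assms unfolding locally_constant_def by blast
  obtain c where c: "c \<le> b" "c \<noteq> bot" "constant_below y c"
    using assms(2) b(2) unfolding locally_constant_def by blast
  show thesis using that[of c] b c constant_below_mono by (metis order_trans)
qed

lemma locally_constant_ops:
  assumes "locally_constant x" "locally_constant y"
  shows "locally_constant (x + y)" "locally_constant (x * y)" "locally_constant (c *\<^sub>R x)"
proof -
  have "\<exists>b\<le>a. b \<noteq> bot \<and> constant_below (x + y) b \<and> constant_below (x * y) b \<and> constant_below (c *\<^sub>R x) b"
    if "a \<noteq> bot" for a
    using locally_constant_common[OF assms that] constant_below_ops by metis
  then show "locally_constant (x + y)" "locally_constant (x * y)" "locally_constant (c *\<^sub>R x)"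
    unfolding locally_constant_def by meson+
qed

lemma locally_constant_ind: "locally_constant (ind e)"
  unfolding locally_constant_def
proof (intro allI impI)
  fix a :: 'a assume a: "a \<noteq> bot"
  show "\<exists>b\<le>a. b \<noteq> bot \<and> constant_below (ind e) b"
  proof (cases "inf a e = bot")
    case True
    then have "ind a * ind e = 0 *\<^sub>R ind a" by (simp add: ind_inf ind_eq_0_iff)
    then show ?thesis using a unfolding constant_below_def by blast
  next
    case False
    have "ind (inf a e) * ind e = 1 *\<^sub>R ind (inf a e)" by (simp add: ind_inf inf.assoc)
    then show ?thesis using False inf_le1[of a e] unfolding constant_below_def by blast
  qed
qed

text \<open>
  For an enumeration \<open>r\<close> of the rationals, \<open>lev n\<close> is the closure of
  \<open>{x < r n}\<close>, so \<open>x \<le> r n\<close> on \<open>lev n\<close> and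
  \<open>x \<ge> r n\<close> on its complement. Distributivity, in its dual form, yields
  below \<open>a\<close> a nonzero \<open>b\<close> that lies for every \<open>n\<close> on one
  side of this alternative. Then no rational separates two values of \<open>x\<close> on
  \<open>b\<close>.
\<close>

lemma sigma_distributive_imp_constant_below:
  fixes x :: "'b::{boolean_algebra,complete_lattice} l0"
  assumes s: "sigma_distributive_below s" and a: "a \<le> s" "a \<noteq> bot"
  obtains b where "b \<le> a" "b \<noteq> bot" "constant_below x b"
proof -
  define r where "r = from_nat_into (\<rat> :: real set)"
  define W where "W n = {q. ultrafilter_on_algebra q \<and> Rep_l0 x q \<in> {..<ereal (r n)}}" for n
  define lev where "lev n = Sup {b. clopen_of b \<subseteq> W n}" for n
  have W: "openin stone_space (W n)" for n
    unfolding W_def by (rule openin_Rep_l0_vimage) simp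
  have cl: "stone_space closure_of W n = clopen_of (lev n)" for n
    unfolding lev_def by (rule closure_of_open_stone_space[OF W])
  have le: "Rep_l0 x q \<le> r n" if "q \<in> clopen_of (lev n)" for q n
  proof -
    have "closedin stone_space {q \<in> topspace stone_space. Rep_l0 x q \<in> {..ereal (r n)}}"
      by (rule closedin_continuous_map_preimage[OF continuous_Rep_l0]) simp
    then have "stone_space closure_of W n \<subseteq> {q \<in> topspace stone_space. Rep_l0 x q \<in> {..ereal (r n)}}"
      by (rule closure_of_minimal[rotated]) (auto simp: W_def topspace_stone_space)
    then show ?thesis using that cl by blast
  qed
  have ge: "r n \<le> Rep_l0 x q" if "ultrafilter_on_algebra q" "lev n \<notin> q" for q n
  proof (rule ccontr)
    assume "\<not> ereal (r n) \<le> Rep_l0 x q"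
    then have "q \<in> W n" using that by (simp add: W_def)
    then have "q \<in> clopen_of (lev n)"
      using closure_of_subset[OF openin_subset[OF W]] cl by blast
    then show False using that by (simp add: clopen_of_def)
  qed
  \<comment> \<open>A sequence of binary choices, padded to a double sequence: all columns with
    \<open>m > 0\<close> agree.\<close>
  define f :: "nat \<Rightarrow> nat \<Rightarrow> 'b" where
    "f n m = (if m = 0 then inf s (- lev n) else inf s (lev n))" for n m
  have "(INF m. f n m) = bot" for n
  proof -
    have "f n 0 \<le> - lev n" "f n 1 \<le> lev n" by (simp_all add: f_def)
    then have "(INF m. f n m) \<le> - lev n" "(INF m. f n m) \<le> lev n"
      using INF_lower[OF UNIV_I, of "f n" 0] INF_lower[OF UNIV_I, of "f n" 1]
      by (blast intro: order_trans)+
    then have "(INF m. f n m) \<le> inf (- lev n) (lev n)" by (rule le_infI)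
    then show ?thesis by (metis bot_unique compl_inf_bot)
  qed
  then have "(SUP n. INF m. f n m) = bot" by simp
  moreover have "f n m \<le> s" for n m by (simp add: f_def)
  ultimately have "(INF \<phi>. SUP n. f n (\<phi> n)) = bot"
    using s unfolding sigma_distributive_below_def by simp
  then have "\<not> (\<forall>\<phi>. a \<le> (SUP n. f n (\<phi> n)))"
    using a(2) le_INF_iff[of a "\<lambda>\<phi>. SUP n. f n (\<phi> n)" UNIV] by (simp add: bot_unique)
  then obtain \<phi> where \<phi>: "\<not> a \<le> (SUP n. f n (\<phi> n))" by blast
  define b where "b = inf a (- (SUP n. f n (\<phi> n)))"
  have "b \<noteq> bot" using \<phi> by (simp add: b_def inf_shunt)
  have dich: "b \<le> lev n \<or> b \<le> - lev n" for n
  proof -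
    have "b \<le> - f n (\<phi> n)"
      unfolding b_def using SUP_upper[OF UNIV_I, of "\<lambda>n. f n (\<phi> n)" n] by (intro le_infI2) simp
    moreover have "b \<le> s" using a(1) unfolding b_def by (rule le_infI1)
    ultimately have "b \<le> inf s (- f n (\<phi> n))" by simp
    moreover have "inf s (- f n (\<phi> n)) \<le> (if \<phi> n = 0 then lev n else - lev n)"
      by (auto simp: f_def inf_sup_distrib1)
    ultimately have "b \<le> (if \<phi> n = 0 then lev n else - lev n)" by (rule order_trans)
    then show ?thesis by presburger
  qed
  have const: "Rep_l0 x p \<le> Rep_l0 x q" if pq: "p \<in> clopen_of b" "q \<in> clopen_of b" for p q
  proof (rule ccontr)
    assume "\<not> Rep_l0 x p \<le> Rep_l0 x q"
    then have "Rep_l0 x q < Rep_l0 x p" by simp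
    then obtain d where d: "Rep_l0 x q < ereal d" "ereal d < Rep_l0 x p"
      using ereal_dense2 by blast
    \<comment> \<open>A second real in between, because \<open>Rep_l0 x p\<close> may be infinite.\<close>
    obtain d' where d': "ereal d < ereal d'" "ereal d' < Rep_l0 x p"
      using ereal_dense2[OF d(2)] by blast
    obtain z where z: "z \<in> \<rat>" "d < z" "z < d'" using Rats_dense_in_real[of d d'] d' by auto
    then obtain n where n: "z = r n"
      unfolding r_def using from_nat_into_surj[OF countable_rat] by metis
    have lt: "Rep_l0 x q < ereal (r n)" "ereal (r n) < Rep_l0 x p"
      using less_trans[OF d(1), of "r n"] less_trans[OF _ d'(2), of "r n"] z n by auto
    have "\<not> b \<le> lev n"
      using le[of p n] lt(2) pq(1) clopen_of_mono[of b "lev n"] by force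
    moreover have "\<not> b \<le> - lev n"
    proof
      assume "b \<le> - lev n"
      then have "q \<in> clopen_of (- lev n)" using clopen_of_mono pq(2) by blast
      then have "ultrafilter_on_algebra q" "lev n \<notin> q" by (auto simp: clopen_of_def uf_compl)
      then show False using ge[of q n] lt(1) by simp
    qed
    ultimately show False using dich by blast
  qed
  obtain q where q: "q \<in> clopen_of b" "fin x q" using fin_exists[OF \<open>b \<noteq> bot\<close>] by blast
  have "constant_below x b"
    unfolding constant_below_iff
  proof (intro exI ballI)
    fix p assume "p \<in> clopen_of b"
    then show "Rep_l0 x p = ereal (val q x)"
      using const[of p q] const[of q p] q Rep_l0_eq_val[OF q(2)] by simp
  qed
  then show thesis using that[of b] \<open>b \<noteq> bot\<close> by (simp add: b_def)
qed

text \<open>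
  Ternary expansions with digits 0 and 1: two of them that agree before position
  \<open>N\<close> differ by the \<open>N\<close>-th digits up to an error of at most half a
  digit. This gives both continuity and injectivity of the coding.
\<close>

lemma ternary_difference:
  fixes s t :: "nat \<Rightarrow> bool"
  assumes agree: "\<And>k. k < N \<Longrightarrow> s k = t k"
  obtains \<theta> :: real where "\<bar>\<theta>\<bar> \<le> 1 / 2"
    "(\<Sum>k. of_bool (s k) * (1/3) ^ k) - (\<Sum>k. of_bool (t k) * (1/3) ^ k)
      = (1/3) ^ N * (of_bool (s N) - of_bool (t N) + \<theta>)"
proof -
  have geo: "summable (\<lambda>k. (1/3 :: real) ^ k)" by (simp add: summable_geometric)
  have sm: "summable (\<lambda>k. c k * (1/3 :: real) ^ k)" if "\<And>k. \<bar>c k\<bar> \<le> 1" for c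
    by (rule summable_comparison_test'[OF geo, of 0])
      (use that in \<open>simp add: abs_mult mult_left_le_one_le\<close>)
  define d :: "nat \<Rightarrow> real" where "d k = of_bool (s k) - of_bool (t k)" for k
  have d: "\<bar>d k\<bar> \<le> 1" for k by (simp add: d_def)
  have smd: "summable (\<lambda>k. d (k + j) * (1/3) ^ k)" for j by (rule sm) (rule d)
  have "(\<Sum>k. of_bool (s k) * (1/3) ^ k) - (\<Sum>k. of_bool (t k) * (1/3) ^ k)
      = (\<Sum>k. d k * (1/3) ^ k)"
    by (subst suminf_diff) (auto simp: d_def left_diff_distrib intro!: sm)
  also have "\<dots> = (\<Sum>k. d (k + N) * (1/3) ^ (k + N))"
    using suminf_split_initial_segment[OF smd[of 0], of N] agree by (simp add: d_def)
  also have "\<dots> = (\<Sum>k. (1/3) ^ N * (d (k + N) * (1/3) ^ k))"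
    by (simp add: power_add mult_ac)
  also have "\<dots> = (1/3) ^ N * (\<Sum>k. d (k + N) * (1/3) ^ k)"
    by (rule suminf_mult) (rule smd)
  also have "(\<Sum>k. d (k + N) * (1/3) ^ k) = d N + (\<Sum>k. d (Suc k + N) * (1/3) ^ Suc k)"
    using suminf_split_head[OF smd[of N]] by simp
  finally have eq: "(\<Sum>k. of_bool (s k) * (1/3) ^ k) - (\<Sum>k. of_bool (t k) * (1/3) ^ k)
      = (1/3) ^ N * (of_bool (s N) - of_bool (t N) + (\<Sum>k. d (Suc k + N) * (1/3) ^ Suc k))"
    by (simp add: d_def)
  have geo': "summable (\<lambda>k. (1/3 :: real) ^ Suc k)"
    using geo by (simp add: summable_Suc_iff)
  have "norm (\<Sum>k. d (Suc k + N) * (1/3) ^ Suc k) \<le> (\<Sum>k. (1/3 :: real) ^ Suc k)"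
    by (rule norm_suminf_le[OF _ geo']) (use d in \<open>simp add: abs_mult mult_left_le_one_le\<close>)
  also have "\<dots> = 1 / 2"
    using suminf_split_head[OF geo] suminf_geometric[of "1/3 :: real"] by simp
  finally show thesis using that eq by (simp only: real_norm_def)
qed

text \<open>
  Up to a given error, the sum depends only on which of the first \<open>N\<close> elements of
  the sequence belong to the ultrafilter, and this is decided on a clopen neighbourhood.
\<close>

lemma continuous_ternary:
  fixes a :: "nat \<Rightarrow> 'b::{boolean_algebra,complete_lattice}"
  shows "continuous_map stone_space euclideanreal (\<lambda>q. \<Sum>k. of_bool (a k \<in> q) * (1/3) ^ k)"
    (is "continuous_map _ _ ?h")
proof -
  have nbhd: "\<exists>b\<in>q. \<forall>p\<in>clopen_of b. \<bar>?h p - ?h q\<bar> < \<epsilon>"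
    if q: "ultrafilter_on_algebra q" and "\<epsilon> > 0" for q \<epsilon>
  proof -
    obtain N where N: "(1/3 :: real) ^ N < \<epsilon> / 2"
      using real_arch_pow_inv[of "\<epsilon> / 2" "1/3"] \<open>\<epsilon> > 0\<close> by auto
    have "\<exists>b\<in>q. \<forall>p\<in>clopen_of b. \<forall>k<N. (a k \<in> p) = (a k \<in> q)"
    proof (induction N)
      case 0
      then show ?case using uf_top[OF q] by blast
    next
      case (Suc N)
      then obtain b where b: "b \<in> q" "\<forall>p\<in>clopen_of b. \<forall>k<N. (a k \<in> p) = (a k \<in> q)" by blast
      define c where "c = (if a N \<in> q then a N else - a N)"
      have "inf b c \<in> q" using b q by (simp add: uf_inf c_def uf_compl)
      moreover have "\<forall>p\<in>clopen_of (inf b c). \<forall>k<Suc N. (a k \<in> p) = (a k \<in> q)"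
      proof (intro ballI allI impI)
        fix p k assume p: "p \<in> clopen_of (inf b c)" and k: "k < Suc N"
        show "(a k \<in> p) = (a k \<in> q)"
        proof (cases "k = N")
          case True
          have "c \<in> p" "ultrafilter_on_algebra p" using p by (auto simp: clopen_of_def uf_inf)
          then show ?thesis using uf_compl[of p "a N"] by (auto simp: True c_def split: if_splits)
        next
          case False
          then show ?thesis using b(2) p k by (simp add: clopen_of_inf)
        qed
      qed
      ultimately show ?case by blast
    qed
    then obtain b where b: "b \<in> q" "\<forall>p\<in>clopen_of b. \<forall>k<N. (a k \<in> p) = (a k \<in> q)" by blast
    have "\<bar>?h p - ?h q\<bar> < \<epsilon>" if p: "p \<in> clopen_of b" for p
    proof -
      have "(a k \<in> p) = (a k \<in> q)" if "k < N" for k using b(2) p that by blast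
      then obtain \<theta> :: real where \<theta>: "\<bar>\<theta>\<bar> \<le> 1 / 2"
        "?h p - ?h q = (1/3) ^ N * (of_bool (a N \<in> p) - of_bool (a N \<in> q) + \<theta>)"
        by (rule ternary_difference)
      have "\<bar>of_bool (a N \<in> p) - of_bool (a N \<in> q) + \<theta>\<bar> \<le> 2" using \<theta>(1) by auto
      then have "\<bar>?h p - ?h q\<bar> \<le> (1/3) ^ N * 2"
        unfolding \<theta>(2) abs_mult by (simp add: mult_left_mono)
      then show ?thesis using N by simp
    qed
    then show ?thesis using b(1) by blast
  qed
  show ?thesis
  proof (rule continuous_map_linorder)
    fix c :: real
    show "openin stone_space {q \<in> topspace stone_space. ?h q < c}"
      unfolding openin_stone_space_iff
    proof
      fix q assume "q \<in> {q \<in> topspace stone_space. ?h q < c}"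
      then have q: "ultrafilter_on_algebra q" "?h q < c" by (auto simp: topspace_stone_space)
      obtain b where b: "b \<in> q" "\<forall>p\<in>clopen_of b. \<bar>?h p - ?h q\<bar> < c - ?h q"
        using nbhd[OF q(1), of "c - ?h q"] q(2) by auto
      have "clopen_of b \<subseteq> {q \<in> topspace stone_space. ?h q < c}"
      proof
        fix p assume "p \<in> clopen_of b"
        moreover from this have "\<bar>?h p - ?h q\<bar> < c - ?h q" using b by blast
        ultimately show "p \<in> {q \<in> topspace stone_space. ?h q < c}"
          by (simp add: topspace_stone_space clopen_of_def)
      qed
      then show "ultrafilter_on_algebra q \<and>
          (\<exists>a\<in>q. clopen_of a \<subseteq> {q \<in> topspace stone_space. ?h q < c})"
        using q(1) b(1) by blast
    qed
    show "openin stone_space {q \<in> topspace stone_space. c < ?h q}"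
      unfolding openin_stone_space_iff
    proof
      fix q assume "q \<in> {q \<in> topspace stone_space. c < ?h q}"
      then have q: "ultrafilter_on_algebra q" "c < ?h q" by (auto simp: topspace_stone_space)
      obtain b where b: "b \<in> q" "\<forall>p\<in>clopen_of b. \<bar>?h p - ?h q\<bar> < ?h q - c"
        using nbhd[OF q(1), of "?h q - c"] q(2) by auto
      have "clopen_of b \<subseteq> {q \<in> topspace stone_space. c < ?h q}"
      proof
        fix p assume "p \<in> clopen_of b"
        moreover from this have "\<bar>?h p - ?h q\<bar> < ?h q - c" using b by blast
        ultimately show "p \<in> {q \<in> topspace stone_space. c < ?h q}"
          by (simp add: topspace_stone_space clopen_of_def)
      qed
      then show "ultrafilter_on_algebra q \<and>
          (\<exists>a\<in>q. clopen_of a \<subseteq> {q \<in> topspace stone_space. c < ?h q})"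
        using q(1) b(1) by blast
    qed
  qed
qed

lemma ternary_injective:
  fixes s t :: "nat \<Rightarrow> bool"
  assumes eq: "(\<Sum>k. of_bool (s k) * (1/3 :: real) ^ k) = (\<Sum>k. of_bool (t k) * (1/3) ^ k)"
  shows "s = t"
proof (rule ccontr)
  assume "s \<noteq> t"
  then have ex: "\<exists>k. s k \<noteq> t k" by blast
  define N where "N = (LEAST k. s k \<noteq> t k)"
  have N: "s N \<noteq> t N" unfolding N_def using ex by (rule LeastI_ex)
  have "s k = t k" if "k < N" for k using that not_less_Least unfolding N_def by blast
  then obtain \<theta> :: real where \<theta>: "\<bar>\<theta>\<bar> \<le> 1 / 2"
    "(\<Sum>k. of_bool (s k) * (1/3 :: real) ^ k) - (\<Sum>k. of_bool (t k) * (1/3) ^ k)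
      = (1/3) ^ N * (of_bool (s N) - of_bool (t N) + \<theta>)"
    by (rule ternary_difference)
  then have "of_bool (s N) - of_bool (t N) + \<theta> = 0" using eq by simp
  then show False using \<theta>(1) N by (cases "s N"; cases "t N") auto
qed

text \<open>
  Let \<open>e\<close> be the difference of the two sides of the distributive law for a double
  sequence \<open>f\<close> that violates it. If the function that codes all
  \<open>f n m\<close> were constant on a nonzero \<open>b \<le> e\<close>, then each
  \<open>f n m\<close> would contain \<open>b\<close> or be disjoint from it. In no row can
  all entries contain \<open>b\<close>, since \<open>b\<close> is disjoint from the left hand
  side; so each row has an entry disjoint from \<open>b\<close>, and a choice of such entries
  contradicts that \<open>b\<close> lies below the right hand side.
\<close>

lemma not_sigma_distributive_imp_nowhere_constant:
  fixes s :: "'b::{boolean_algebra,complete_lattice}"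
  assumes "\<not> sigma_distributive_below s"
  obtains e h where "e \<le> s" "e \<noteq> bot" "continuous_map stone_space euclideanreal h"
    "\<And>b. b \<le> e \<Longrightarrow> b \<noteq> bot \<Longrightarrow> \<not> constant_below (of_continuous h) b"
proof -
  obtain f :: "nat \<Rightarrow> nat \<Rightarrow> 'b" where f: "\<And>n m. f n m \<le> s"
    "(SUP n. INF m. f n m) \<noteq> (INF \<phi>. SUP n. f n (\<phi> n))"
    using assms unfolding sigma_distributive_below_def by blast
  define L where "L = (SUP n. INF m. f n m)"
  define R where "R = (INF \<phi>. SUP n. f n (\<phi> n))"
  have "L \<le> R"
    unfolding L_def R_def
  proof (rule SUP_least, rule INF_greatest)
    fix n :: nat and \<phi> :: "nat \<Rightarrow> nat"
    have "(INF m. f n m) \<le> f n (\<phi> n)" by (rule INF_lower) simp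
    also have "\<dots> \<le> (SUP n. f n (\<phi> n))" by (rule SUP_upper) simp
    finally show "(INF m. f n m) \<le> (SUP n. f n (\<phi> n))" .
  qed
  define e where "e = inf R (- L)"
  have "e \<noteq> bot"
    using f(2) \<open>L \<le> R\<close> unfolding e_def inf_shunt L_def[symmetric] R_def[symmetric] by auto
  have "e \<le> s"
  proof -
    have "R \<le> (SUP n. f n 0)" unfolding R_def by (rule INF_lower2[of "\<lambda>_. 0"]) auto
    also have "\<dots> \<le> s" by (rule SUP_least) (rule f(1))
    finally show ?thesis unfolding e_def by (rule le_infI1)
  qed
  define a where "a k = (case prod_decode k of (n, m) \<Rightarrow> f n m)" for k
  define h where "h q = (\<Sum>k. of_bool (a k \<in> q) * (1/3 :: real) ^ k)" for q
  have h: "continuous_map stone_space euclideanreal h"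
    unfolding h_def[abs_def] by (rule continuous_ternary)
  have "\<not> constant_below (of_continuous h) b" if b: "b \<le> e" "b \<noteq> bot" for b
  proof
    assume "constant_below (of_continuous h) b"
    then obtain c where c: "Rep_l0 (of_continuous h) q = ereal c" if "q \<in> clopen_of b" for q
      unfolding constant_below_iff by blast
    have same: "f n m \<in> p \<longleftrightarrow> f n m \<in> q" if pq: "p \<in> clopen_of b" "q \<in> clopen_of b" for p q n m
    proof -
      have "h p = h q"
        using c[OF pq(1)] c[OF pq(2)] pq
        by (simp add: of_continuous_props(1)[OF h] topspace_stone_space clopen_of_def)
      then have "(\<lambda>k. a k \<in> p) = (\<lambda>k. a k \<in> q)" unfolding h_def by (rule ternary_injective)
      then have "a (prod_encode (n, m)) \<in> p \<longleftrightarrow> a (prod_encode (n, m)) \<in> q" by meson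
      then show ?thesis by (simp add: a_def)
    qed
    obtain q where q: "q \<in> clopen_of b" using b(2) clopen_of_eq_empty_iff[of b] by blast
    have uq: "ultrafilter_on_algebra q" using q by (simp add: clopen_of_def)
    have below: "b \<le> d" if "\<And>p. p \<in> clopen_of b \<Longrightarrow> d \<in> p" for d
    proof -
      have "clopen_of (inf b (- d)) = {}"
        unfolding clopen_of_inf using that by (auto simp: clopen_of_def uf_compl)
      then show ?thesis unfolding clopen_of_eq_empty_iff inf_shunt by simp
    qed
    have "\<exists>m. f n m \<notin> q" for n
    proof (rule ccontr)
      assume "\<nexists>m. f n m \<notin> q"
      then have "b \<le> f n m" for m using same[OF _ q] by (intro below) blast
      then have "b \<le> (INF m. f n m)" by (intro INF_greatest)
      also have "\<dots> \<le> L" unfolding L_def by (rule SUP_upper) simp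
      finally have "b \<le> L" .
      moreover have "b \<le> - L" using b(1) unfolding e_def by simp
      ultimately have "b \<le> inf L (- L)" by (rule le_infI)
      then show False using b(2) by (metis bot_unique inf_compl_bot)
    qed
    then obtain \<phi> where \<phi>: "f n (\<phi> n) \<notin> q" for n by metis
    have "inf b (SUP n. f n (\<phi> n)) = bot"
    proof (rule inf_Sup_eq_bot)
      fix d assume "d \<in> range (\<lambda>n. f n (\<phi> n))"
      then obtain n where d: "d = f n (\<phi> n)" by blast
      have "b \<le> - d"
        using same[OF _ q] \<phi> by (intro below) (auto simp: d clopen_of_def uf_compl)
      then show "inf b d = bot" by (simp add: inf_shunt)
    qed
    moreover have "b \<le> (SUP n. f n (\<phi> n))"
    proof (rule order_trans)
      show "b \<le> R" using b(1) unfolding e_def by simp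
      show "R \<le> (SUP n. f n (\<phi> n))" unfolding R_def by (rule INF_lower) simp
    qed
    ultimately show False using b(2) by (simp add: inf.absorb1)
  qed
  then show thesis using that \<open>e \<noteq> bot\<close> \<open>e \<le> s\<close> h by blast
qed


section \<open>A derivation that does not vanish at a nowhere constant element\<close>

lemma fin_poly:
  assumes "\<And>i. fin (coeff p i) q" "fin v q"
  shows "fin (poly p v) q \<and> val q (poly p v) = poly (map_poly (val q) p) (val q v)"
  using assms(1)
proof (induction p)
  case 0
  then show ?case using assms(2) by (simp add: fin_ops val_ops fin_uf)
next
  case (pCons a p)
  have "fin a q" using pCons.prems[of 0] by simp
  moreover have "fin (coeff p i) q" for i using pCons.prems[of "Suc i"] by simp
  moreover have "val q 0 = 0" using assms(2) by (simp add: val_ops fin_uf)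
  ultimately show ?case
    using pCons.IH assms(2) by (simp add: map_poly_pCons fin_ops val_ops)
qed

lemma map_poly_val_fderiv:
  assumes "\<And>i. fin (coeff p i) q"
  shows "map_poly (val q) (fderiv p) = pderiv (map_poly (val q) p)"
proof -
  have "val q 0 = 0" using assms[of 0] by (simp add: val_ops fin_uf)
  then show ?thesis
    by (intro poly_eqI) (simp add: coeff_map_poly coeff_fderiv coeff_pderiv val_ops assms)
qed

text \<open>
  On a small clopen set the coefficients of \<open>p\<close> are real numbers. If they are not
  all zero, then \<open>v\<close> takes only finitely many values there, hence is constant near
  each point, which is excluded below \<open>e\<close>. So \<open>p\<close> is zero on that set,
  and so is its derivative.
\<close>

lemma transcendental_if_nowhere_constant:
  fixes v :: "'b::{boolean_algebra,complete_lattice} l0"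
  assumes p: "\<And>i. locally_constant (coeff p i)" "poly p v = 0"
    and nc: "\<And>b. b \<le> e \<Longrightarrow> b \<noteq> bot \<Longrightarrow> \<not> constant_below v b"
  shows "ind e * poly (fderiv p) v = 0"
proof (rule ccontr)
  let ?t = "poly (fderiv p) v"
  assume "ind e * ?t \<noteq> 0"
  then have "inf e (supp ?t) \<noteq> bot" by (simp add: ind_mult_eq_0_iff_le inf_shunt)
  then obtain b where b: "b \<le> inf e (supp ?t)" "b \<noteq> bot" "\<And>q. q \<in> clopen_of b \<Longrightarrow> Rep_l0 ?t q \<noteq> 0"
    using not_vanishing_below_supp[of "inf e (supp ?t)" ?t] by auto
  have "\<exists>c\<le>b. c \<noteq> bot \<and> (\<forall>i<n. constant_below (coeff p i) c)" for n
  proof (induction n)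
    case (Suc n)
    then obtain c where c: "c \<le> b" "c \<noteq> bot" "\<forall>i<n. constant_below (coeff p i) c" by blast
    obtain d where d: "d \<le> c" "d \<noteq> bot" "constant_below (coeff p n) d"
      using p(1)[of n] c(2) unfolding locally_constant_def by blast
    have "\<forall>i<Suc n. constant_below (coeff p i) d"
      using c(3) d constant_below_mono less_Suc_eq by metis
    then show ?case using c(1) d order_trans by blast
  qed (use b in auto)
  then obtain c where c: "c \<le> b" "c \<noteq> bot" "\<forall>i<Suc (degree p). constant_below (coeff p i) c" by blast
  obtain d where d: "d \<le> c" "d \<noteq> bot" "\<And>q. q \<in> clopen_of d \<Longrightarrow> fin v q"
    using common_finite_clopen[of "{v}" c] c(2) by (metis finite.emptyI finite.insertI singletonI)
  have const: "constant_below (coeff p i) d" for i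
  proof (cases "i \<le> degree p")
    case True
    then have "constant_below (coeff p i) c" using c(3) by simp
    then show ?thesis using d(1) by (rule constant_below_mono)
  next
    case False
    then have "ind d * coeff p i = 0 *\<^sub>R ind d" by (simp add: coeff_eq_0)
    then show ?thesis unfolding constant_below_def by blast
  qed
  then obtain k where k: "\<And>i q. q \<in> clopen_of d \<Longrightarrow> Rep_l0 (coeff p i) q = ereal (k i)"
    unfolding constant_below_iff by metis
  have finp: "fin (coeff p i) q" if "q \<in> clopen_of d" for i q
    using that k[OF that, of i] by (simp add: fin_def clopen_of_def)
  obtain q0 where q0: "q0 \<in> clopen_of d" using d(2) clopen_of_eq_empty_iff[of d] by blast
  define P where "P = map_poly (val q0) p"
  have P: "map_poly (val q) p = P" if q: "q \<in> clopen_of d" for q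
  proof (rule poly_eqI)
    fix i
    have "val q 0 = 0" "val q0 0 = 0" using q q0 by (auto simp: val_ops clopen_of_def)
    moreover have "val q (coeff p i) = val q0 (coeff p i)" using k[OF q] k[OF q0] by (simp add: val_def)
    ultimately show "coeff (map_poly (val q) p) i = coeff P i" by (simp add: P_def coeff_map_poly)
  qed
  have root: "poly P (val q v) = 0" if q: "q \<in> clopen_of d" for q
    using fin_poly[of p q v] finp[OF q] d(3)[OF q] P[OF q] p(2) by (simp add: val_ops fin_uf)
  have "P \<noteq> 0"
  proof
    assume "P = 0"
    then have "map_poly (val q0) (fderiv p) = 0"
      using map_poly_val_fderiv[OF finp[OF q0]] by (simp add: P_def)
    moreover have "fin (coeff (fderiv p) i) q0" for i
      using finp[OF q0] by (simp add: coeff_fderiv fin_ops)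
    ultimately have "fin ?t q0" "val q0 ?t = 0"
      using fin_poly[of "fderiv p" q0 v] d(3)[OF q0] by auto
    then have "Rep_l0 ?t q0 = 0" by (simp add: Rep_l0_eq_val)
    moreover have "q0 \<in> clopen_of b" using q0 clopen_of_mono c(1) d(1) by blast
    ultimately show False using b(3) by blast
  qed
  \<comment> \<open>Removing the other roots isolates the value of \<open>v\<close> at
    \<open>q0\<close>.\<close>
  define Z where "Z = ereal ` ({z. poly P z = 0} - {val q0 v})"
  have "finite Z" unfolding Z_def using poly_roots_finite[OF \<open>P \<noteq> 0\<close>] by blast
  then have "open (- Z)" by (intro open_Compl finite_imp_closed)
  then have W: "openin stone_space {q. ultrafilter_on_algebra q \<and> Rep_l0 v q \<in> - Z}"
    by (rule openin_Rep_l0_vimage)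
  have "q0 \<in> {q. ultrafilter_on_algebra q \<and> Rep_l0 v q \<in> - Z} \<inter> clopen_of d"
    using q0 Rep_l0_eq_val[OF d(3)[OF q0]] by (auto simp: Z_def clopen_of_def)
  then obtain b' where b': "b' \<le> d" "b' \<noteq> bot"
    "clopen_of b' \<subseteq> {q. ultrafilter_on_algebra q \<and> Rep_l0 v q \<in> - Z}"
    using openin_meets_clopen[OF W, of d] by blast
  have "Rep_l0 v q = ereal (val q0 v)" if q: "q \<in> clopen_of b'" for q
  proof -
    have qd: "q \<in> clopen_of d" using q clopen_of_mono[OF b'(1)] by blast
    have "Rep_l0 v q \<notin> Z" using q b'(3) by blast
    then have "val q v = val q0 v"
      using root[OF qd] Rep_l0_eq_val[OF d(3)[OF qd]] by (auto simp: Z_def)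
    then show ?thesis using Rep_l0_eq_val[OF d(3)[OF qd]] by simp
  qed
  then have "constant_below v b'" unfolding constant_below_iff by blast
  moreover have "b' \<le> e" using b'(1) d(1) c(1) b(1) by (meson le_infE order_trans)
  ultimately show False using nc b'(2) by blast
qed

lemma locally_constant_derivation:
  "partial_derivation (range ind) (ind (top :: 'b::{boolean_algebra,complete_lattice})) {x. locally_constant x} (\<lambda>_. 0)"
proof (intro partial_derivation.intro partial_derivation_axioms.intro L0.saturated_algebra_axioms)
  show "range ind \<subseteq> {x :: 'b l0. locally_constant x}" using locally_constant_ind by blast
  show "c *\<^sub>R a \<in> {x. locally_constant x}" if "a \<in> {x. locally_constant x}" for a :: "'b l0" and c
    using that locally_constant_ops(3)[of a a] by simp
qed (simp_all add: locally_constant_ops(1,2))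

text \<open>
  The value \<open>ind e\<close> at \<open>v\<close> is admissible for the zero derivation on
  the locally constant elements, by the transcendence of \<open>v\<close>.
\<close>

lemma nonzero_derivation_exists:
  fixes v :: "'b::{boolean_algebra,complete_lattice} l0"
  assumes "\<And>b. b \<le> e \<Longrightarrow> b \<noteq> bot \<Longrightarrow> \<not> constant_below v b"
  obtains D :: "'b l0 \<Rightarrow> 'b l0" where "D v = ind e"
    "\<And>a b. D (a + b) = D a + D b" "\<And>a b. D (a * b) = D a * b + a * D b"
    "\<And>c a. D (c *\<^sub>R a) = c *\<^sub>R D a" "\<And>a. D (ind a) = 0"
proof -
  interpret P: partial_derivation "range ind" "ind (top :: 'b)" "{x. locally_constant x}" "\<lambda>_. 0"
    by (rule locally_constant_derivation)
  have y: "poly (map_poly (\<lambda>_. 0) p) v + ind e * poly (fderiv p) v = 0"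
    if "P.over p" "poly p v = 0" for p
  proof -
    have "locally_constant (coeff p i)" for i using that(1) by (simp add: P.over_def)
    then have "ind e * poly (fderiv p) v = 0"
      by (rule transcendental_if_nowhere_constant[OF _ that(2) assms])
    moreover have "map_poly (\<lambda>_. 0 :: 'b l0) p = 0"
      by (rule poly_eqI) (simp add: coeff_map_poly)
    ultimately show ?thesis by simp
  qed
  note G = P.derivation_graph_adjoin[OF y]
  obtain D where D: 
    "\<And>a b. (a, b) \<in> {(poly p v, poly (map_poly (\<lambda>_. 0) p) v + ind e * poly (fderiv p) v) |p. P.over p}
      \<Longrightarrow> D a = b"
    "\<And>a b. D (a + b) = D a + D b" "\<And>a b. D (a * b) = D a * b + a * D b"
    "\<And>c a. D (c *\<^sub>R a) = c *\<^sub>R D a"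
    using L0.derivation_graph_extends[OF G(1)] by blast
  show thesis
  proof (rule that)
    show "D v = ind e" by (rule D(1)[OF G(3)])
    fix a
    have "locally_constant (ind a :: 'b l0)" by (rule locally_constant_ind)
    then have "ind a \<in> {x :: 'b l0. locally_constant x}" by (rule CollectI)
    then show "D (ind a) = 0" using D(1)[OF G(2)] by blast
  qed (fact D)+
qed


section \<open>Derivations on ideals\<close>

text \<open>
  Some \<open>z \<in> X\<close> is nonzero throughout a clopen set \<open>b\<close> below
  \<open>a\<close>, and \<open>b\<close> is a multiple of \<open>z\<close> by a continuous real
  function.
\<close>

lemma ideal_contains_idempotent:
  fixes X :: "'b::{boolean_algebra,complete_lattice} L0 set"
  assumes X: "CQ_ideal X" and a: "a \<le> L0_support_set X" "a \<noteq> bot"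
  obtains b where "b \<le> a" "b \<noteq> bot" "Rep_l0 (ind b) \<in> X"
proof -
  have XC: "X \<subseteq> CQ_carrier" and ideal: "\<And>x y. x \<in> CQ_carrier \<Longrightarrow> y \<in> X \<Longrightarrow> L0_mult x y \<in> X"
    using X unfolding CQ_ideal_def CQ_subalgebra_def by blast+
  have "inf a (L0_support_set X) \<noteq> bot" using a by (simp add: inf.absorb1)
  then obtain z where z: "z \<in> X" "inf a (L0_support z) \<noteq> bot"
    unfolding L0_support_set_def using inf_Sup_eq_bot[of "L0_support ` X" a] by blast
  have zC: "z \<in> C_real stone_space" using z(1) XC unfolding CQ_carrier_def by blast
  define x where "x = Abs_l0 z"
  have x: "Rep_l0 x = z"
    unfolding x_def by (rule Abs_l0_inverse) (use zC in \<open>simp add: L0_carrier_def C_real_def\<close>)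
  have finx: "fin x q" if "ultrafilter_on_algebra q" for q
    using zC that by (simp add: fin_def x C_real_def topspace_stone_space)
  obtain b where b: "b \<le> inf a (supp x)" "b \<noteq> bot" "\<And>q. q \<in> clopen_of b \<Longrightarrow> Rep_l0 x q \<noteq> 0"
    using not_vanishing_below_supp[of "inf a (supp x)" x] z(2) x by auto
  have nz: "val q x \<noteq> 0" if "ultrafilter_on_algebra q" "b \<in> q" for q
    using b(3)[of q] that Rep_l0_eq_val[OF finx[OF that(1)]] by (simp add: clopen_of_def)
  define i where "i = (\<lambda>q. of_bool (b \<in> q) :: real)"
  \<comment> \<open>The function \<open>1 / z\<close> on \<open>b\<close> and 0 elsewhere, written
    as one quotient whose denominator has no zero, so that continuity is immediate.\<close>
  define h where "h q = i q * val q x / ((val q x)\<^sup>2 + (1 - i q))" for q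
  have cx: "continuous_map stone_space euclideanreal (\<lambda>q. val q x)"
    using continuous_val[of "topspace stone_space" x] finx
    unfolding subtopology_topspace by (simp add: topspace_stone_space)
  have ci: "continuous_map stone_space euclideanreal i"
    unfolding i_def by (rule continuous_indicator)
  have h: "continuous_map stone_space euclideanreal h"
    unfolding h_def[abs_def]
  proof (intro continuous_map_real_divide continuous_map_add continuous_map_diff
      continuous_map_real_mult continuous_map_real_pow cx ci continuous_map_const[THEN iffD2])
    fix q assume "q \<in> topspace (stone_space :: 'b set topology)"
    then have "ultrafilter_on_algebra q" by (simp add: topspace_stone_space)
    then show "(val q x)\<^sup>2 + (1 - i q) \<noteq> 0"
      using nz[of q] by (cases "b \<in> q") (auto simp: i_def add_nonneg_eq_0_iff)
  qed auto
  have "of_continuous h * x = ind b"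
  proof (rule l0_eqI[of "{0 :: 'b l0}"])
    fix q assume "\<forall>z\<in>{0 :: 'b l0}. fin z q"
    then have uq: "ultrafilter_on_algebra q" by (simp add: fin_uf)
    have "h q * val q x = of_bool (b \<in> q)"
      using nz[OF uq] by (cases "b \<in> q") (auto simp: h_def i_def power2_eq_square)
    then show "fin (of_continuous h * x) q \<and> fin (ind b) q \<and> val q (of_continuous h * x) = val q (ind b)"
      using finx[OF uq] of_continuous_props(2,3)[OF h uq] by (simp add: fin_ops val_ops fin_ind val_ind uq)
  qed simp
  then have "Rep_l0 (ind b) = L0_mult (Rep_l0 (of_continuous h)) z" by (metis Rep_l0_ops(3) x)
  then have "Rep_l0 (ind b) \<in> X" using ideal[OF of_continuous_props(4)[OF h] z(1)] by simp
  moreover have "b \<le> a" using b(1) by simp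
  ultimately show thesis using that b(2) by blast
qed

theorem theorem4p3:
  fixes X :: "'b::{boolean_algebra,complete_lattice} L0 set"
  assumes "CQ_ideal X"
  shows "sigma_distributive_below (L0_support_set X) \<longleftrightarrow>
         \<not> (\<exists>\<delta>. L0_derivation X \<delta> \<and> band_preserving X \<delta> \<and> (\<exists>x\<in>X. \<delta> x \<noteq> L0_zero))"
proof -
  have XC: "X \<subseteq> CQ_carrier" and Xmult: "\<And>x y. x \<in> X \<Longrightarrow> y \<in> X \<Longrightarrow> L0_mult x y \<in> X"
    and Xscale: "\<And>c x. x \<in> X \<Longrightarrow> L0_scale c x \<in> X"
    and ideal: "\<And>x y. x \<in> CQ_carrier \<Longrightarrow> y \<in> X \<Longrightarrow> L0_mult x y \<in> X"
    using assms unfolding CQ_ideal_def CQ_subalgebra_def by blast+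
  have XL: "X \<subseteq> L0_carrier" using XC unfolding CQ_carrier_def L0_carrier_def C_real_def by blast
  have Rep_Abs: "Rep_l0 (Abs_l0 x) = x" if "x \<in> X" for x
    using Abs_l0_inverse that XL by blast
  show ?thesis
  proof (intro iffI notI)
    assume sigma: "sigma_distributive_below (L0_support_set X)"
      and "\<exists>\<delta>. L0_derivation X \<delta> \<and> band_preserving X \<delta> \<and> (\<exists>x\<in>X. \<delta> x \<noteq> L0_zero)"
    then obtain \<delta> z where \<delta>: "L0_derivation X \<delta>" "band_preserving X \<delta>" and z: "z \<in> X" "\<delta> z \<noteq> L0_zero"
      by blast
    define D where "D x = Abs_l0 (\<delta> (Rep_l0 x))" for x
    have RepD: "Rep_l0 (D x) = \<delta> (Rep_l0 x)" if "Rep_l0 x \<in> X" for x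
      unfolding D_def using \<delta>(1) that by (intro Abs_l0_inverse) (auto simp: L0_derivation_def)
    have Dmult: "D (x * y) = D x * y + x * D y" if "Rep_l0 x \<in> X" "Rep_l0 y \<in> X" for x y
    proof -
      have "Rep_l0 (D (x * y)) = Rep_l0 (D x * y + x * D y)"
        using \<delta>(1) that Xmult[OF that]
        by (simp add: RepD Rep_l0_ops L0_derivation_def)
      then show ?thesis by (simp add: Rep_l0_inject)
    qed
    have Dscale: "D (c *\<^sub>R x) = c *\<^sub>R D x" if "Rep_l0 x \<in> X" for c x
    proof -
      have "Rep_l0 (D (c *\<^sub>R x)) = Rep_l0 (c *\<^sub>R D x)"
        using \<delta>(1) that Xscale[OF that] by (simp add: RepD Rep_l0_ops L0_derivation_def)
      then show ?thesis by (simp add: Rep_l0_inject)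
    qed
    define x where "x = Abs_l0 z"
    have xX: "Rep_l0 x \<in> X" using z(1) Rep_Abs by (simp add: x_def)
    have "D x \<noteq> 0"
      using z(2) RepD[OF xX] by (metis Rep_Abs Rep_l0_ops(1) x_def z(1))
    then have "supp (D x) \<noteq> bot" by (simp add: supp_eq_bot_iff)
    moreover have "supp (D x) \<le> L0_support_set X"
    proof -
      have "supp (D x) \<le> supp x" using \<delta>(2) xX RepD[OF xX] by (simp add: band_preserving_def)
      also have "\<dots> \<le> L0_support_set X"
        unfolding L0_support_set_def using xX by (intro SUP_upper)
      finally show ?thesis .
    qed
    ultimately obtain a where a: "a \<le> supp (D x)" "a \<noteq> bot" "Rep_l0 (ind a) \<in> X"
      using ideal_contains_idempotent[OF assms] by metis
    have "a \<le> L0_support_set X" using a(1) \<open>supp (D x) \<le> L0_support_set X\<close> by (rule order_trans)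
    then obtain b where b: "b \<le> a" "b \<noteq> bot" "constant_below x b"
      using sigma_distributive_imp_constant_below[OF sigma _ a(2)] by metis
    have "Rep_l0 (ind b) = L0_mult (Rep_l0 (ind b)) (Rep_l0 (ind a))"
      using b(1) ind_inf[of b a] by (metis Rep_l0_ops(3) inf.absorb1)
    moreover have "Rep_l0 (ind b) \<in> CQ_carrier"
      unfolding ind_def by (rule of_continuous_props(4)[OF continuous_indicator])
    ultimately have bX: "Rep_l0 (ind b) \<in> X" using ideal a(3) by metis
    have Db: "D (ind b) = 0"
    proof -
      have 1: "D (ind b) = D (ind b) * ind b + ind b * D (ind b)"
        using Dmult[OF bX bX] by (simp add: ind_inf)
      then have "ind b * D (ind b) = ind b * (D (ind b) * ind b + ind b * D (ind b))" by simp
      also have "\<dots> = ind b * D (ind b) + ind b * D (ind b)"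
        by (simp add: distrib_left mult.assoc[symmetric] ind_inf mult.commute[of "D (ind b)"])
      finally have "ind b * D (ind b) = 0" by simp
      then show ?thesis using 1 by (simp add: mult.commute)
    qed
    obtain c where c: "ind b * x = c *\<^sub>R ind b" using b(3) unfolding constant_below_def by blast
    have "ind b * D x = D (ind b * x)" using Dmult[OF bX xX] Db by simp
    also have "\<dots> = 0" using Dscale[OF bX] Db by (simp add: c)
    finally have "b \<le> - supp (D x)" by (simp add: ind_mult_eq_0_iff_le)
    moreover have "b \<le> supp (D x)" using a(1) b(1) by (rule order_trans[rotated])
    ultimately have "b \<le> inf (supp (D x)) (- supp (D x))" by (rule le_infI[rotated])
    then show False using b(2) by (metis bot_unique inf_compl_bot)
  next
    assume no: "\<not> (\<exists>\<delta>. L0_derivation X \<delta> \<and> band_preserving X \<delta> \<and> (\<exists>x\<in>X. \<delta> x \<noteq> L0_zero))"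
    show "sigma_distributive_below (L0_support_set X)"
    proof (rule ccontr)
      assume "\<not> sigma_distributive_below (L0_support_set X)"
      then obtain e h where e: "e \<le> L0_support_set X" "e \<noteq> bot"
        and h: "continuous_map stone_space euclideanreal h"
        and nc: "\<And>b. b \<le> e \<Longrightarrow> b \<noteq> bot \<Longrightarrow> \<not> constant_below (of_continuous h) b"
        using not_sigma_distributive_imp_nowhere_constant by blast
      obtain a where a: "a \<le> e" "a \<noteq> bot" "Rep_l0 (ind a) \<in> X"
        using ideal_contains_idempotent[OF assms e] by blast
      define v where "v = of_continuous h * ind a"
      have vX: "Rep_l0 v \<in> X"
        unfolding v_def Rep_l0_ops using of_continuous_props(4)[OF h] a(3) by (rule ideal)
      have ncv: "\<not> constant_below v b" if b: "b \<le> a" "b \<noteq> bot" for b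
      proof -
        have "ind b * v = ind b * ind a * of_continuous h" by (simp add: v_def mult_ac)
        then have "ind b * v = ind b * of_continuous h" using b(1) by (simp add: ind_inf inf.absorb1)
        moreover have "b \<le> e" using b(1) a(1) by (rule order_trans)
        ultimately show ?thesis using nc[of b] b(2) by (simp add: constant_below_def)
      qed
      obtain D where D: "D v = ind a"
        "\<And>a b. D (a + b) = D a + D b" "\<And>a b. D (a * b) = D a * b + a * D b"
        "\<And>c a. D (c *\<^sub>R a) = c *\<^sub>R D a" "\<And>a. D (ind a) = 0"
        using nonzero_derivation_exists[OF ncv] by metis
      define \<delta> where "\<delta> x = Rep_l0 (D (Abs_l0 x))" for x
      have Abs_ops: "Abs_l0 (L0_add x y) = Abs_l0 x + Abs_l0 y"
        "Abs_l0 (L0_mult x y) = Abs_l0 x * Abs_l0 y"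
        "Abs_l0 (L0_scale c x) = c *\<^sub>R Abs_l0 x" if "x \<in> X" "y \<in> X" for x y c
        using that by (simp_all add: Rep_Abs plus_l0_def times_l0_def scaleR_l0_def)
      have "L0_derivation X \<delta>"
        unfolding L0_derivation_def
      proof (intro conjI ballI allI funcsetI)
        show "\<delta> x \<in> L0_carrier" for x unfolding \<delta>_def by (rule Rep_l0)
        fix x y c assume "x \<in> X"
        show "\<delta> (L0_scale c x) = L0_scale c (\<delta> x)"
          unfolding \<delta>_def Abs_ops(3)[OF \<open>x \<in> X\<close> \<open>x \<in> X\<close>] D(4) Rep_l0_ops ..
        assume "y \<in> X"
        show "\<delta> (L0_add x y) = L0_add (\<delta> x) (\<delta> y)"
          unfolding \<delta>_def Abs_ops(1)[OF \<open>x \<in> X\<close> \<open>y \<in> X\<close>] D(2) Rep_l0_ops ..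
        show "\<delta> (L0_mult x y) = L0_add (L0_mult (\<delta> x) y) (L0_mult x (\<delta> y))"
          unfolding \<delta>_def Abs_ops(2)[OF \<open>x \<in> X\<close> \<open>y \<in> X\<close>] D(3) Rep_l0_ops
            Rep_Abs[OF \<open>x \<in> X\<close>] Rep_Abs[OF \<open>y \<in> X\<close>] ..
      qed
      moreover have "band_preserving X \<delta>"
        unfolding band_preserving_def
      proof
        fix z assume z: "z \<in> X"
        define x where "x = Abs_l0 z"
        have "ind (- supp x) * x = 0" by (simp add: ind_mult_eq_0_iff_le)
        then have "D (ind (- supp x) * x) = D (0 *\<^sub>R x)" by simp
        then have "ind (- supp x) * D x = 0" unfolding D(3-5) by simp
        then have "- supp x \<le> - supp (D x)" by (simp add: ind_mult_eq_0_iff_le)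
        then have "supp (D x) \<le> supp x" by simp
        then show "L0_support (\<delta> z) \<le> L0_support z" by (simp add: \<delta>_def x_def Rep_Abs[OF z])
      qed
      moreover have "\<delta> (Rep_l0 v) \<noteq> L0_zero"
      proof
        assume "\<delta> (Rep_l0 v) = L0_zero"
        then have "Rep_l0 (ind a) = Rep_l0 0" by (simp add: \<delta>_def Rep_l0_inverse D(1) Rep_l0_ops)
        then show False using a(2) by (simp add: Rep_l0_inject ind_eq_0_iff)
      qed
      ultimately show False using no vX by blast
    qed
  qed
qed

end
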